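(* Every $U_5$-free tournament $G$ has a transitive subtournament with at least $|V(G)|^{\log_3 2}$ vertices. Moreover, there are infinitely many $U_5$-free tournaments $G$ which have no transitive subtournament with more than $|V(G)|^{\log_3 2}$ vertices.
   Context: A tournament is a finite loopless directed graph in which for any two distinct vertices $u,v$ there is exactly one edge between them; write $u\rightarrow v$ for the edge from $u$ to $v$. A subtournament is a tournament induced on a subset of vertices; it is transitive if it contains no cyclic triangle (three vertices $a\rightarrow b\rightarrow c\rightarrow a$). For tournaments $G,H$, $G$ is $H$-free if no subtournament of $G$ is isomorphic to $H$. $U_5$ is the tournament on $v_1,\dots,v_5$ with $v_2\rightarrow v_1$, and $v_i\rightarrow v_j$ whenever $j-i\equiv 1,2\pmod 5$ and $\{i,j\}\neq\{1,2\}$. *)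

theory Defs
  imports
    Complex_Main
    "HOL-Number_Theory.Cong"
    "Graph_Theory.Digraph_Component"
    "Graph_Theory.Digraph_Isomorphism"
begin

text \<open>
  The locale \<open>digraph\<close> already excludes infinite graphs, loops and parallel arcs, so exactly one
  edge between \<open>u\<close> and \<open>v\<close> means that exactly one of the two directions occurs.
\<close>

locale tournament = digraph +
  assumes exactly_one_direction:
    "\<lbrakk>u \<in> verts G; v \<in> verts G; u \<noteq> v\<rbrakk> \<Longrightarrow> (u \<rightarrow>\<^bsub>G\<^esub> v) \<noteq> (v \<rightarrow>\<^bsub>G\<^esub> u)"

text \<open>
  In a tournament \<open>a\<close>, \<open>b\<close>, \<open>c\<close> below are automatically distinct vertices, as there are no loops.
\<close>

definition is_transitive :: "('a, 'b) pre_digraph \<Rightarrow> bool" where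
  "is_transitive T \<longleftrightarrow> \<not> (\<exists>a b c. a \<rightarrow>\<^bsub>T\<^esub> b \<and> b \<rightarrow>\<^bsub>T\<^esub> c \<and> c \<rightarrow>\<^bsub>T\<^esub> a)"

definition is_free_of :: "('a, 'b) pre_digraph \<Rightarrow> ('c, 'd) pre_digraph \<Rightarrow> bool" where
  "is_free_of G H \<longleftrightarrow> \<not> (\<exists>S \<subseteq> verts G. digraph_iso (G \<restriction> S) H)"

text \<open>The vertices are integers so that \<open>j - i\<close> below is not truncated.\<close>

definition U5 :: "(int, int \<times> int) pre_digraph" where
  "U5 = \<lparr> verts = {1..5},
          arcs = insert (2, 1) {(i, j). i \<in> {1..5} \<and> j \<in> {1..5} \<and>
            ([j - i = 1] (mod 5) \<or> [j - i = 2] (mod 5)) \<and> {i, j} \<noteq> {1, 2}},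
          tail = fst, head = snd \<rparr>"

lemma interval_1_5: "{1..5::int} = {1, 2, 3, 4, 5}"
  by auto

lemma arcs_U5:
  "arcs U5 = {(2,1), (1,3), (2,3), (2,4), (3,4), (3,5), (4,5), (4,1), (5,1), (5,2)}"
proof -
  have "arcs U5 = insert (2, 1) (Set.filter (\<lambda>(i, j).
      ((j - i) mod 5 = 1 \<or> (j - i) mod 5 = 2) \<and> {i, j} \<noteq> {1, 2})
      ({1, 2, 3, 4, 5} \<times> {1, 2, 3, 4, 5}))"
    unfolding U5_def by (simp only: interval_1_5[symmetric]) (auto simp: cong_def)
  also have "\<dots> = {(2,1), (1,3), (2,3), (2,4), (3,4), (3,5), (4,5), (4,1), (5,1), (5,2)}"
    by code_simp
  finally show ?thesis .
qed

end

theory Submission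
  imports Defs "HOL-Library.Numeral_Type" "HOL-Analysis.Convex"
begin

text \<open>
  For the lower bound, let \<open>\<alpha> = log\<^sub>2 3\<close>. We show the stronger weighted inequality
  \<open>\<Sum> w v powr \<alpha> \<le> (\<Sum> w v over S) powr \<alpha>\<close> for some transitive \<open>S\<close>. It is preserved when a homogeneous
  set is contracted to a point, so that the tournament may be assumed to be indecomposable. Then any
  two cyclic triangles are joined by a chain of triangles in which neighbours share an edge. If a
  copy of the circular tournament \<open>T\<^sub>5\<close> exists, then following such chains shows that no vertex
  dominates or is dominated by a triangle; hence a vertex together with its out- or in-neighbourhood
  is transitive, which bounds the weights. Without a copy of \<open>T\<^sub>5\<close>, the chains consistently label
  the vertices by the three corners of a triangle, and every cyclic triangle is rainbow. So the union
  of any two of the three classes is transitive, and convexity finishes the proof.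
  The bound is attained by the iterated substitution of a cyclic triangle into itself.
\<close>

section \<open>Cyclic triangles in indecomposable tournaments\<close>

text \<open>The arguments stand for \<open>v_1, ..., v_5\<close> in this order. Any two of them are
  joined by an arc, so in a tournament they are automatically distinct.\<close>

definition U5_at :: "('a \<Rightarrow> 'a \<Rightarrow> bool) \<Rightarrow> 'a \<Rightarrow> 'a \<Rightarrow> 'a \<Rightarrow> 'a \<Rightarrow> 'a \<Rightarrow> bool" where
  "U5_at E a b c d e \<longleftrightarrow>
    E b a \<and> E a c \<and> E b c \<and> E b d \<and> E c d \<and> E c e \<and> E d e \<and> E d a \<and> E e a \<and> E e b"

text \<open>\<open>E\<close> is a bare relation on a carrier, so that reversing all arcs and
  restricting to a subset stay within the same type.\<close>

locale relational_tournament =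
  fixes V :: "'a set" and E :: "'a \<Rightarrow> 'a \<Rightarrow> bool"
  assumes finite_V: "finite V"
    and E_in: "E x y \<Longrightarrow> x \<in> V \<and> y \<in> V"
    and asym: "E x y \<Longrightarrow> \<not> E y x"
    and total: "x \<in> V \<Longrightarrow> y \<in> V \<Longrightarrow> x \<noteq> y \<Longrightarrow> E x y \<or> E y x"
begin

definition Tri :: "'a \<Rightarrow> 'a \<Rightarrow> 'a \<Rightarrow> bool" where
  "Tri a b c \<longleftrightarrow> E a b \<and> E b c \<and> E c a"

definition homogeneous :: "'a set \<Rightarrow> bool" where
  "homogeneous M \<longleftrightarrow> M \<subseteq> V \<and> (\<forall>v\<in>V - M. (\<forall>m\<in>M. E v m) \<or> (\<forall>m\<in>M. E m v))"

definition indecomposable :: bool where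
  "indecomposable \<longleftrightarrow> (\<forall>M. homogeneous M \<longrightarrow> card M \<le> 1 \<or> M = V)"

text \<open>Connectedness of cyclic triangles, two of them being adjacent if they share an edge.\<close>

inductive con :: "'a \<Rightarrow> 'a \<Rightarrow> 'a \<Rightarrow> 'a \<Rightarrow> 'a \<Rightarrow> 'a \<Rightarrow> bool" for a b c where
  base: "con a b c a b c"
| rot: "con a b c x y z \<Longrightarrow> con a b c y z x"
| rep: "con a b c x y z \<Longrightarrow> Tri x y w \<Longrightarrow> con a b c x y w"

lemma irrefl: "\<not> E x x"
  using asym by blast

lemma Tri_rot: "Tri a b c \<Longrightarrow> Tri b c a"
  by (auto simp: Tri_def)

lemma con_Tri: "con a b c x y z \<Longrightarrow> Tri a b c \<Longrightarrow> Tri x y z"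
  by (induction rule: con.induct) (auto simp: Tri_def)

lemma con_trans: "con x y z u v w \<Longrightarrow> con a b c x y z \<Longrightarrow> con a b c u v w"
  by (induction rule: con.induct) (auto intro: con.intros)

lemma con_sym: "con a b c x y z \<Longrightarrow> Tri a b c \<Longrightarrow> con x y z a b c"
proof (induction rule: con.induct)
  case base
  show ?case by (rule con.base)
next
  case (rot x y z)
  have "con y z x x y z" by (blast intro: con.base con.rot)
  with rot show ?case by (blast intro: con_trans)
next
  case (rep x y z w)
  have "con x y w x y z"
    using con_Tri[OF rep.hyps(1) rep.prems] by (blast intro: con.base con.rep)
  with rep show ?case by (blast intro: con_trans)
qed

lemma con_share:
  assumes "con a b c x y z" "Tri x y w" "Tri a b c"
  shows "con x y w a b c"
  by (meson assms con.rep con_sym)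

text \<open>The set \<open>M\<close> of vertices on triangles connected to \<open>a b c\<close> is
  homogeneous: a vertex outside \<open>M\<close> cannot replace a corner of such a triangle, so it
  dominates all three corners or is dominated by all three, and as adjacent triangles share corners,
  the direction is the same throughout. Since \<open>M\<close> contains \<open>a\<close> and
  \<open>b\<close>, it is all of \<open>V\<close>.\<close>

lemma con_cover:
  assumes ind: "indecomposable" and t: "Tri a b c" and v: "v \<in> V"
  shows "\<exists>y z. con a b c v y z"
proof -
  define M where "M = {v. \<exists>y z. con a b c v y z}"
  have dich: "(E v x \<and> E v y \<and> E v z) \<or> (E x v \<and> E y v \<and> E z v)"
    if "con a b c x y z" and vM: "v \<in> V - M" for x y z v
  proof -
    have T: "Tri x y z" using con_Tri that t by blast
    have n: "v \<noteq> x" "v \<noteq> y" "v \<noteq> z"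
      using that(1) vM con.rot unfolding M_def by blast+
    have in3: "x \<in> V" "y \<in> V" "z \<in> V" using T E_in unfolding Tri_def by blast+
    have "\<not> con a b c x y v" "\<not> con a b c y z v" "\<not> con a b c z x v"
      using vM con.rot unfolding M_def by blast+
    then have "\<not> Tri x y v" "\<not> Tri y z v" "\<not> Tri z x v"
      using that(1) by (metis con.rep con.rot)+
    then show ?thesis using n in3 vM total T unfolding Tri_def by blast
  qed
  have unif: "(E v x \<longrightarrow> E v a) \<and> (E x v \<longrightarrow> E a v) \<and> (E v y \<longrightarrow> E v a) \<and> (E y v \<longrightarrow> E a v)
      \<and> (E v z \<longrightarrow> E v a) \<and> (E z v \<longrightarrow> E a v)"
    if "con a b c x y z" "v \<in> V - M" for x y z v
    using that
  proof (induction rule: con.induct)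
    case base
    then show ?case using dich[OF con.base] asym by blast
  next
    case (rot x y z)
    then show ?case by blast
  next
    case (rep x y z w)
    then show ?case using dich[OF con.rep[OF rep.hyps]] asym by blast
  qed
  have MV: "M \<subseteq> V"
    using con_Tri t E_in unfolding M_def Tri_def by blast
  have "homogeneous M"
    unfolding homogeneous_def
  proof (intro conjI ballI MV)
    fix v assume v: "v \<in> V - M"
    have av: "E v a \<or> E a v" using dich[OF con.base v] by blast
    have "(E v a \<longrightarrow> E v m) \<and> (E a v \<longrightarrow> E m v)" if m: "m \<in> M" for m
    proof -
      obtain y z where "con a b c m y z" using m unfolding M_def by blast
      then show ?thesis using dich[OF _ v] unif[OF _ v] asym by blast
    qed
    then show "(\<forall>m\<in>M. E v m) \<or> (\<forall>m\<in>M. E m v)" using av by blast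
  qed
  moreover have "\<not> card M \<le> 1"
  proof
    assume "card M \<le> 1"
    moreover have "a \<in> M" "b \<in> M" unfolding M_def by (blast intro: con.base con.rot)+
    moreover have "finite M" using MV finite_V finite_subset by blast
    ultimately have "a = b" using card_le_Suc0_iff_eq[of M] by auto
    then show False using t irrefl unfolding Tri_def by blast
  qed
  ultimately have "M = V" using ind unfolding indecomposable_def by blast
  then show ?thesis using v M_def by blast
qed

text \<open>Up to exchanging the two triangles, one of them sits inside the other one like a vertex
  substituted by a homogeneous set.\<close>

lemma two_triangles:
  assumes t: "Tri a q r" and s: "Tri a b c" and n: "\<not> con a q r a b c"
  shows "(E q b \<and> E r b \<and> E c q \<and> E c r) \<or> (E b q \<and> E c q \<and> E r b \<and> E r c)"
proof -
  \<comment> \<open>Triangles connected to the two given ones never share an edge, since this would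
    connect the given ones.\<close>
  have sh: "\<not> (con a b c x y z \<and> con a q r x y w)" for x y z w
    using n s t con_Tri con_share con_sym con_trans con.rep by metis
  have cs: "con a b c a b c" "con a b c b c a" "con a b c c a b"
    and ct: "con a q r a q r" "con a q r q r a" "con a q r r a q"
    by (blast intro: con.base con.rot)+
  have in5: "a \<in> V" "b \<in> V" "c \<in> V" "q \<in> V" "r \<in> V"
    using t s E_in unfolding Tri_def by blast+
  have ne: "b \<noteq> q" "c \<noteq> r" "b \<noteq> r" "c \<noteq> q"
    using sh cs ct t s asym unfolding Tri_def by blast+
  have "\<not> E q c"
  proof
    assume "E q c"
    then have "Tri c a q" using t s unfolding Tri_def by blast
    then have "con a b c c a q" "con a q r a q c"
      using cs ct con.rep Tri_rot by blast+
    then show False using sh con.rot by blast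
  qed
  then have cq: "E c q" using total in5 ne by blast
  have "\<not> E b r"
  proof
    assume "E b r"
    then have "Tri a b r" using t s unfolding Tri_def by blast
    then have "con a b c a b r" "con a q r r a b"
      using cs ct con.rep Tri_rot by blast+
    then show False using sh con.rot by blast
  qed
  then have rb: "E r b" using total in5 ne by blast
  have "\<not> (E b q \<and> E c r)"
  proof
    assume A: "E b q \<and> E c r"
    then have "Tri b c r" "Tri q r b" "Tri r b c" using rb t s unfolding Tri_def by blast+
    then have "con a b c b c r" "con a q r q r b"
      using cs ct con.rep by blast+
    then show False using sh con.rot by blast
  qed
  moreover have "\<not> (E q b \<and> E r c)"
  proof
    assume A: "E q b \<and> E r c"
    then have "Tri b c q" "Tri q r c" using cq t s unfolding Tri_def by blast+
    then have "con a b c b c q" "con a q r q r c"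
      using cs ct con.rep by blast+
    then show False using sh con.rot by blast
  qed
  ultimately show ?thesis using cq rb total in5 ne by blast
qed

text \<open>Here \<open>q\<close> and \<open>r\<close> relate to \<open>b\<close> and
  \<open>c\<close> as \<open>a\<close> does. By \<open>two_triangles\<close> this persists along
  every chain from \<open>a q r\<close>, but some chain arrives at a triangle through
  \<open>b\<close> itself, which gives a loop.\<close>

lemma con_all_aux:
  assumes ind: "indecomposable" and t: "Tri a q r" and s: "Tri a b c"
    and n: "\<not> con a q r a b c" and h: "E q b \<and> E r b \<and> E c q \<and> E c r"
  shows False
proof -
  have "E x b \<and> E y b \<and> E z b \<and> E c x \<and> E c y \<and> E c z" if "con a q r x y z" for x y z
    using that
  proof (induction rule: con.induct)
    case base
    then show ?case using s h unfolding Tri_def by blast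
  next
    case (rot x y z)
    then show ?case by blast
  next
    case (rep x y z w)
    have s': "Tri x b c" using rep.IH s unfolding Tri_def by blast
    have cs: "con x b c a b c"
      using s s' by (blast intro: con.base con.rot con.rep Tri_rot)
    have "\<not> con x y w x b c"
    proof
      assume "con x y w x b c"
      then have "con x y w a b c" using cs con_trans by blast
      then have "con a q r a b c" using rep.hyps con.rep con_trans by blast
      then show False using n by blast
    qed
    from two_triangles[OF rep.hyps(2) s' this] rep.IH asym
    show ?case by blast
  qed
  moreover obtain y z where "con a q r b y z"
    using con_cover[OF ind t] s E_in unfolding Tri_def by blast
  ultimately show False using irrefl by blast
qed

text \<open>By \<open>con_cover\<close> a chain reaches some triangle through \<open>x\<close>. If
  that one is not connected to \<open>x y z\<close>, then \<open>con_all_aux\<close> refutes both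
  alternatives of \<open>two_triangles\<close>, the second one with the triangles exchanged.\<close>

lemma con_all:
  assumes ind: "indecomposable" and t: "Tri a b c" and s: "Tri x y z"
  shows "con a b c x y z"
proof (rule ccontr)
  assume n: "\<not> con a b c x y z"
  obtain q r where c: "con a b c x q r"
    using con_cover[OF ind t] s E_in unfolding Tri_def by blast
  have t': "Tri x q r" using c con_Tri t by blast
  have n1: "\<not> con x q r x y z" using n c con_trans by blast
  have n2: "\<not> con x y z x q r" using n1 con_sym s by blast
  show False
    using two_triangles[OF t' s n1] con_all_aux[OF ind t' s n1] con_all_aux[OF ind s t' n2] by blast
qed

end

section \<open>Cyclic triangles and copies of the circular tournament\<close>

locale U5_free_tournament = relational_tournament +
  assumes noU5: "\<not> U5_at E a b c d e"
begin

text \<open>The circular tournament: each of five cyclically ordered vertices dominates the next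
  two. Reversing the arc from \<open>a\<close> to \<open>b\<close> turns it into
  \<open>U5_at E a b c d e\<close>.\<close>

definition T5 :: "'a \<Rightarrow> 'a \<Rightarrow> 'a \<Rightarrow> 'a \<Rightarrow> 'a \<Rightarrow> bool" where
  "T5 a b c d e \<longleftrightarrow>
    E a b \<and> E a c \<and> E b c \<and> E b d \<and> E c d \<and> E c e \<and> E d e \<and> E d a \<and> E e a \<and> E e b"

text \<open>A cyclic triangle in the circular tournament has exactly one edge between cyclic
  neighbours; the three disjuncts say which edge it is. \<open>D\<close> will be domination by a
  vertex, or constantly true for mere containment.\<close>

definition in_T5 :: "('a \<Rightarrow> bool) \<Rightarrow> 'a \<Rightarrow> 'a \<Rightarrow> 'a \<Rightarrow> bool" where
  "in_T5 D x y z \<longleftrightarrow> (\<exists>c e. D x \<and> D y \<and> D z \<and> D c \<and> D e \<and>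
     (T5 x y c z e \<or> T5 z x c y e \<or> T5 y z c x e))"

text \<open>If \<open>w\<close> is new, forbidding \<open>U5\<close> fixes enough arcs at
  \<open>w\<close> to put it into a circular tournament with four of the old vertices. That
  \<open>c'\<close> and \<open>e'\<close> are old is what later lets domination be carried
  along.\<close>

lemma T5_step:
  assumes T: "T5 x y c z e \<or> T5 z x c y e \<or> T5 y z c x e" and w: "E y w" "E w x"
  shows "\<exists>c' e'. {c', e'} \<subseteq> {x, y, c, z, e} \<and> (T5 x y c' w e' \<or> T5 w x c' y e' \<or> T5 y w c' x e')"
proof (cases "w \<in> {c, z, e}")
  case True
  then show ?thesis using T w asym unfolding T5_def by blast
next
  case False
  have in6: "w \<in> V" "c \<in> V" "z \<in> V" "e \<in> V" using w T E_in unfolding T5_def by blast+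
  have tot: "E w c \<or> E c w" "E w z \<or> E z w" "E w e \<or> E e w" using total in6 False by blast+
  from T show ?thesis
  proof (elim disjE)
    assume "T5 x y c z e"
    then have "T5 x y c w e"
      using tot w noU5[of w e x y c] noU5[of x e y w z] noU5[of c y z w x] noU5[of c w e x y]
      unfolding T5_def U5_at_def by argo
    then show ?thesis by blast
  next
    assume "T5 z x c y e"
    then have "T5 w x c y e \<or> T5 y w z x c"
      using tot w noU5[of w z x c y] noU5[of x z c w e] noU5[of e y z w c] noU5[of e w x c y]
      unfolding T5_def U5_at_def by argo
    then show ?thesis by blast
  next
    assume "T5 y z c x e"
    then have "T5 y w c x e \<or> T5 w x e y z"
      using tot w noU5[of w c x e y] noU5[of x c e w z] noU5[of z y c w e] noU5[of z w x e y]
      unfolding T5_def U5_at_def by argo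
    then show ?thesis by blast
  qed
qed

text \<open>If the fifth vertex dominated \<open>v\<close>, then \<open>v\<close> in the place two
  steps after it would complete a circular tournament with one arc between neighbours reversed,
  which is a \<open>U5\<close>.\<close>

lemma T5_four_out:
  assumes T: "T5 a b c d e" and v: "v \<in> V"
    and v4: "E v a \<and> E v b \<and> E v c \<and> E v d \<or> E v a \<and> E v b \<and> E v c \<and> E v e \<or>
      E v a \<and> E v b \<and> E v d \<and> E v e \<or> E v a \<and> E v c \<and> E v d \<and> E v e \<or>
      E v b \<and> E v c \<and> E v d \<and> E v e"
  shows "E v a \<and> E v b \<and> E v c \<and> E v d \<and> E v e"
proof -
  have in5: "a \<in> V" "b \<in> V" "c \<in> V" "d \<in> V" "e \<in> V" using T E_in unfolding T5_def by blast+
  have "v \<noteq> a" "v \<noteq> b" "v \<noteq> c" "v \<noteq> d" "v \<noteq> e"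
    using T v4 asym irrefl unfolding T5_def by metis+
  then have "E v a \<or> E a v" "E v b \<or> E b v" "E v c \<or> E c v" "E v d \<or> E d v" "E v e \<or> E e v"
    using total v in5 by blast+
  then show ?thesis
    using T v4 noU5[of b v d e a] noU5[of c v e a b] noU5[of d v a b c] noU5[of e v b c d] noU5[of a v c d e]
    unfolding T5_def U5_at_def by argo
qed

text \<open>After each replacement the new circular tournament has four vertices that
  \<open>v\<close> already dominates, so \<open>T5_four_out\<close> yields the fifth.\<close>

lemma in_T5_con:
  assumes "con a b c x y z" "Tri a b c" "in_T5 (E v) a b c"
  shows "in_T5 (E v) x y z"
  using assms
proof (induction rule: con.induct)
  case base
  then show ?case by simp
next
  case (rot x y z)
  then show ?case unfolding in_T5_def by blast
next
  case (rep x y z w)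
  then obtain c e where D: "E v x" "E v y" "E v z" "E v c" "E v e"
    and T: "T5 x y c z e \<or> T5 z x c y e \<or> T5 y z c x e" unfolding in_T5_def by blast
  obtain c' e' where D': "E v c'" "E v e'" and T': "T5 x y c' w e' \<or> T5 w x c' y e' \<or> T5 y w c' x e'"
    using T5_step[OF T, of w] rep.hyps(2) D unfolding Tri_def by blast
  have "v \<in> V" using D E_in by blast
  then have "E v w" using T' T5_four_out[where v = v] D D' by metis
  then show ?case using D D' T' unfolding in_T5_def by blast
qed

lemma in_T5_con_True:
  assumes "con a b c x y z" "Tri a b c" "in_T5 (\<lambda>_. True) a b c"
  shows "in_T5 (\<lambda>_. True) x y z"
  using assms
proof (induction rule: con.induct)
  case base
  then show ?case by simp
next
  case (rot x y z)
  then show ?case unfolding in_T5_def by blast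
next
  case (rep x y z w)
  then obtain c e where T: "T5 x y c z e \<or> T5 z x c y e \<or> T5 y z c x e" unfolding in_T5_def by blast
  show ?case using T5_step[OF T, of w] rep.hyps(2) unfolding in_T5_def Tri_def by blast
qed

text \<open>Connectedness puts every cyclic triangle into a circular tournament. If \<open>v\<close>
  dominates one triangle, it dominates the whole circular tournament around it, hence by
  connectedness every cyclic triangle. But \<open>v\<close> itself lies on one.\<close>

lemma no_dominated_triangle:
  assumes ind: "indecomposable" and T: "T5 p q r s u" and t: "Tri x y z"
    and v: "E v x" "E v y" "E v z"
  shows False
proof -
  have pqs: "Tri p q s" using T unfolding T5_def Tri_def by blast
  have "in_T5 (\<lambda>_. True) p q s" using T unfolding in_T5_def by blast
  then have "in_T5 (\<lambda>_. True) x y z" using in_T5_con_True con_all[OF ind pqs t] pqs by blast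
  then obtain c e where T': "T5 x y c z e \<or> T5 z x c y e \<or> T5 y z c x e"
    unfolding in_T5_def by blast
  have aux: "E v c \<and> E v e" if T: "T5 a b c d e" and D: "E v a" "E v b" "E v d" for a b c d e
  proof -
    have in3: "v \<in> V" "c \<in> V" "e \<in> V" using T D E_in unfolding T5_def by blast+
    have "v \<noteq> c" "v \<noteq> e" using T D asym unfolding T5_def by blast+
    then have "E v c \<or> E c v" "E v e \<or> E e v" using total in3 by blast+
    then show ?thesis
      using T D noU5[of a v c d e] noU5[of d v a b c] noU5[of d c e v b]
      unfolding T5_def U5_at_def by blast
  qed
  have "in_T5 (E v) x y z" using T' v aux unfolding in_T5_def by blast
  then have all: "in_T5 (E v) x' y' z'" if "Tri x' y' z'" for x' y' z'
    using in_T5_con con_all[OF ind t that] t by blast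
  obtain y' z' where c: "con x y z v y' z'" using con_cover[OF ind t] v E_in by blast
  then have "E v v" using all con_Tri t unfolding in_T5_def by blast
  then show False using irrefl by blast
qed

end

section \<open>Labels in the absence of the circular tournament\<close>

lemma cases_mod_3: "(d::3) = c \<or> d = c + 1 \<or> d = c - 1"
proof -
  have "i = 0 \<or> i = 1 \<or> i = - 1" for i :: 3
  proof (cases i)
    case (of_int z)
    then have "z = 0 \<or> z = 1 \<or> z = 2" by auto
    then show ?thesis using of_int by auto
  qed
  from this[of "d - c"] show ?thesis by (auto simp: algebra_simps)
qed

lemma minus_2_mod_3: "(c::3) - 2 = c + 1" "(c::3) + 2 = c - 1" "(c::3) + 1 + 1 = c - 1" "(c::3) - 1 - 1 = c + 1"
  by (simp_all add: algebra_simps)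

context relational_tournament
begin

text \<open>Corners are indexed modulo 3, so that exchanging a corner is a function update which
  leaves the other indices in place.\<close>

definition cyc :: "(3 \<Rightarrow> 'a) \<Rightarrow> bool" where
  "cyc t \<longleftrightarrow> (\<forall>i. E (t i) (t (i + 1)))"

text \<open>For a cyclic triangle \<open>t\<close> this means that \<open>v\<close> may replace the
  corner \<open>c\<close>, see \<open>cyc_upd\<close>.\<close>

definition lab :: "3 \<Rightarrow> 'a \<Rightarrow> (3 \<Rightarrow> 'a) \<Rightarrow> bool" where
  "lab c v t \<longleftrightarrow> E v (t (c + 1)) \<and> E (t (c - 1)) v"

definition dominates_tri :: "'a \<Rightarrow> (3 \<Rightarrow> 'a) \<Rightarrow> bool" where
  "dominates_tri v t \<longleftrightarrow> (\<forall>i. E v (t i))"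

lemma cyc_nexts:
  assumes "cyc t"
  shows "E (t c) (t (c + 1))" "E (t (c + 1)) (t (c - 1))" "E (t (c - 1)) (t c)"
proof -
  show "E (t c) (t (c + 1))" using assms by (simp add: cyc_def)
  show "E (t (c + 1)) (t (c - 1))" using assms[unfolded cyc_def, rule_format, of "c + 1"] minus_2_mod_3 by simp
  show "E (t (c - 1)) (t c)" using assms[unfolded cyc_def, rule_format, of "c - 1"] by simp
qed

lemma all_3: "(\<forall>i. P i) \<longleftrightarrow> P c \<and> P (c + 1) \<and> P (c - (1::3))"
  by (metis cases_mod_3)

lemma cyc_iff: "cyc t \<longleftrightarrow> E (t c) (t (c + 1)) \<and> E (t (c + 1)) (t (c - 1)) \<and> E (t (c - 1)) (t c)"
  unfolding cyc_def by (subst all_3[where c = c]) (simp add: minus_2_mod_3)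

lemma cyc_upd:
  assumes "cyc t"
  shows "cyc (t(d := y)) \<longleftrightarrow> lab d y t"
  using assms unfolding cyc_iff[of _ d] lab_def by auto

lemma lab_self: "cyc t \<Longrightarrow> lab c (t c) t"
  using cyc_nexts unfolding lab_def by blast

lemma lab_unique: "lab c v t \<Longrightarrow> lab d v t \<Longrightarrow> c = d"
  using cases_mod_3[of d c] asym unfolding lab_def by (auto simp: minus_2_mod_3)

lemma dominates_not_lab: "dominates_tri v t \<Longrightarrow> \<not> lab c v t"
  using asym unfolding dominates_tri_def lab_def by blast

text \<open>If the arcs between \<open>v\<close> and the corners do not all have the same direction,
  then going around the triangle they change exactly once from leaving \<open>v\<close> to entering
  \<open>v\<close>.\<close>

lemma lab_cases:
  assumes "cyc t" "v \<in> V"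
  shows "dominates_tri v t \<or> (\<forall>i. E (t i) v) \<or> (\<exists>c. lab c v t)"
proof (cases "\<exists>c. v = t c")
  case True
  then show ?thesis using lab_self assms by blast
next
  case False
  have "E v (t i) \<or> E (t i) v" for i
    using False total assms(2) cyc_nexts[OF assms(1)] E_in by metis
  then show ?thesis
    unfolding dominates_tri_def lab_def
    unfolding all_3[where c = 0] by (metis minus_2_mod_3 add_0 diff_0 diff_add_cancel)
qed

end

locale T5_U5_free_tournament = U5_free_tournament +
  assumes noT5: "\<not> T5 a b c d e"
begin

text \<open>The five vertices form a \<open>U5\<close> if \<open>y\<close> dominates
  \<open>q\<close>, and a circular tournament if \<open>q\<close> dominates
  \<open>y\<close>.\<close>

lemma lab_step_core:
  assumes "Tri p q r" "Tri p y r" "E v p" "E v q" "E y v" "E r v"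
  shows False
proof -
  have "q \<noteq> y" using assms asym by blast
  then have "E q y \<or> E y q" using total E_in assms by blast
  then show False
    using assms noU5[of q y r v p] noT5[of p q y r v] unfolding Tri_def U5_at_def T5_def by blast
qed

text \<open>A changed label would contradict one of the old arcs at \<open>v\<close> unless the
  replaced corner is \<open>c - 1\<close> or \<open>c + 1\<close>, and then
  \<open>lab_step_core\<close> applies.\<close>

lemma lab_step:
  assumes t: "cyc t" and y: "lab d y t" and c: "lab c v t" and c': "lab c' v (t(d := y))"
  shows "c' = c"
proof (rule ccontr)
  assume "c' \<noteq> c"
  then have "c' = c + 1 \<or> c' = c - 1" using cases_mod_3 by blast
  then show False
  proof
    assume A: "c' = c + 1"
    have B: "E v ((t(d := y)) (c - 1))" "E ((t(d := y)) c) v"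
      using c' A unfolding lab_def by (auto simp: minus_2_mod_3)
    have C: "E v (t (c + 1))" "E (t (c - 1)) v" using c unfolding lab_def by auto
    have d: "d = c - 1" using B(1) C(2) asym by (metis fun_upd_other)
    then have B': "E v y" "E (t c) v" using B by auto
    have "E y (t c)" "E (t (c + 1)) y" using y d unfolding lab_def by (auto simp: minus_2_mod_3)
    then show False
      using lab_step_core[of "t (c + 1)" y "t c" "t (c - 1)" v] B' C cyc_nexts[OF t, of c]
      unfolding Tri_def by blast
  next
    assume A: "c' = c - 1"
    have B: "E v ((t(d := y)) c)" "E ((t(d := y)) (c + 1)) v"
      using c' A unfolding lab_def by (auto simp: minus_2_mod_3)
    have C: "E v (t (c + 1))" "E (t (c - 1)) v" using c unfolding lab_def by auto
    have d: "d = c + 1" using B(2) C(1) asym by (metis fun_upd_other)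
    then have B': "E v (t c)" "E y v" using B by auto
    have "E y (t (c - 1))" "E (t c) y" using y d unfolding lab_def by (auto simp: minus_2_mod_3)
    then show False
      using lab_step_core[of "t c" "t (c + 1)" "t (c - 1)" y v] B' C cyc_nexts[OF t, of c]
      unfolding Tri_def by blast
  qed
qed

text \<open>If \<open>t c\<close> dominated \<open>w\<close>, then \<open>v\<close>,
  \<open>w\<close> and the three corners would form a \<open>U5\<close>.\<close>

lemma lab_two_out:
  assumes t: "cyc t" and v: "dominates_tri v t" and w: "E w v" "lab c w t"
  shows "E w (t c)"
proof (rule ccontr)
  assume "\<not> E w (t c)"
  moreover have "w \<noteq> t c" using v w asym unfolding dominates_tri_def by blast
  ultimately have "E (t c) w" using total w t cyc_nexts[OF t] E_in by metis
  then show False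
    using noU5[of "t (c + 1)" v "t (c - 1)" "t c" w] v w cyc_nexts[OF t, of c]
    unfolding dominates_tri_def U5_at_def lab_def by blast
qed

text \<open>Only the arcs between \<open>u\<close> and \<open>w\<close>, \<open>u\<close> and
  \<open>r\<close>, \<open>w\<close> and \<open>p\<close> are open, and each choice of their
  directions produces a \<open>U5\<close>.\<close>

lemma same_lab_core:
  assumes "Tri p q r" "E v p" "E v q" "E v r" "E u v" "E w v" "E u p" "E q u" "E w q" "E r w"
  shows False
proof -
  have "u \<noteq> w" "u \<noteq> r" "w \<noteq> p" using assms asym by blast+
  then have "E u w \<or> E w u" "E u r \<or> E r u" "E w p \<or> E p w" using total E_in assms by blast+
  then show False
    using assms noU5[of p v q r u] noU5[of q v r p w] noU5[of p w q u r] noU5[of r u w v q]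
    unfolding Tri_def U5_at_def by blast
qed

lemma same_lab:
  assumes t: "cyc t" and v: "dominates_tri v t" and u: "E u v" "lab c u t" and w: "E w v" "lab d w t"
  shows "c = d"
proof (rule ccontr)
  assume "c \<noteq> d"
  then have "d = c + 1 \<or> c = d + 1" using cases_mod_3[of d c] by auto
  then show False
  proof
    assume d: "d = c + 1"
    then show False
      using same_lab_core[of "t (c + 1)" "t (c - 1)" "t c" v u w] cyc_nexts[OF t, of c] v u w
      unfolding dominates_tri_def lab_def Tri_def by (auto simp: minus_2_mod_3)
  next
    assume d: "c = d + 1"
    then show False
      using same_lab_core[of "t (d + 1)" "t (d - 1)" "t d" v w u] cyc_nexts[OF t, of d] v u w
      unfolding dominates_tri_def lab_def Tri_def by (auto simp: minus_2_mod_3)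
  qed
qed

text \<open>
  A vertex \<open>x 0\<close> that was labelled \<open>c\<close> may later dominate the moving triangle \<open>t\<close>. The chain remembers
  its label: \<open>x 1\<close> is the corner that left \<open>t\<close> when \<open>x 0\<close> began to dominate it, and so on, each
  time with the preceding label modulo 3. The vertices dominated by a triangle are handled in
  the reversed tournament, where the triangle is read as \<open>\<lambda>i. t (- i)\<close>.
\<close>

definition chain :: "nat \<Rightarrow> (nat \<Rightarrow> 'a) \<Rightarrow> 3 \<Rightarrow> (3 \<Rightarrow> 'a) \<Rightarrow> bool" where
  "chain k x c t \<longleftrightarrow> (\<forall>j<k. dominates_tri (x j) t) \<and> (\<forall>j<k. E (x (Suc j)) (x j)) \<and>
     (\<forall>j l. j + 2 \<le> l \<and> l \<le> k \<longrightarrow> E (x j) (x l)) \<and> lab (c - of_nat k) (x k) t"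

lemma chain_shift:
  assumes "chain k x c t" "j \<le> k"
  shows "chain (k - j) (\<lambda>i. x (i + j)) (c - of_nat j) t"
  using assms unfolding chain_def by (auto simp: of_nat_diff)

lemma dominates_upd: "dominates_tri v t \<Longrightarrow> E v y \<Longrightarrow> dominates_tri v (t(d := y))"
  unfolding dominates_tri_def by simp

text \<open>For length one this is \<open>same_lab\<close>. A longer chain is shortened by moving
  its last vertex into the triangle, which does not affect the label of \<open>y\<close>. The result
  locates the corner at which a vertex dominating a chain element can enter.\<close>

lemma chain_back:
  assumes "chain k x c t" "k \<ge> 1" "cyc t" "E y (x 0)" "lab d y t"
  shows "d = c - 1"
  using assms
proof (induction k arbitrary: t)
  case 0
  then show ?case by simp
next
  case (Suc k)
  note ch = Suc.prems(1)[unfolded chain_def]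
  note t = Suc.prems(3) and y0 = Suc.prems(4) and y = Suc.prems(5)
  show ?case
  proof (cases "k = 0")
    case True
    then show ?thesis using same_lab[OF t, of "x 0" "x 1" "c - 1" y d] ch y0 y by auto
  next
    case False
    define z where "z = x (Suc k)"
    define e where "e = c - of_nat (Suc k)"
    \<comment> \<open>With \<open>z\<close> at corner \<open>e\<close> the chain is one shorter and
      ends in \<open>x k\<close> with label \<open>e + 1\<close>. It remains to see that
      \<open>y\<close> keeps its label.\<close>
    define t' where "t' = t(e := z)"
    have z: "lab e z t" using ch unfolding e_def z_def by blast
    have t': "cyc t'" unfolding t'_def using cyc_upd t z by blast
    have zk: "E z (x k)" and xk: "dominates_tri (x k) t" using ch unfolding z_def by auto
    have zte: "E z (t e)" using lab_two_out[OF t xk zk z] .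
    have x0: "dominates_tri (x 0) t" "E (x 0) z" using ch False unfolding z_def by auto
    have yd: "E y (t d)" using lab_two_out[OF t x0(1) y0 y] .
    have yz: "y \<noteq> z" using x0 y0 asym by blast
    have yz': "E y z \<or> E z y" using total yz E_in y0 zk by blast
    have e: "c - of_nat k = e + 1" unfolding e_def by simp
    have "chain k x c t'"
      unfolding chain_def
    proof (intro conjI allI impI)
      fix j assume "j < k"
      then show "dominates_tri (x j) t'" using ch unfolding t'_def z_def by (auto intro!: dominates_upd)
    next
      show "lab (c - of_nat k) (x k) t'"
        using xk zk unfolding e lab_def dominates_tri_def t'_def by (auto simp: minus_2_mod_3)
    qed (use ch in auto)
    moreover have "lab d y t'"
    proof -
      consider "e = d" | "e = d + 1" | "e = d - 1" using cases_mod_3 by blast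
      then show ?thesis
      proof cases
        case 1
        then show ?thesis using y unfolding lab_def t'_def by auto
      next
        case 2
        have "E y z"
        proof (rule ccontr)
          assume "\<not> E y z"
          then have "E z y" using yz' by blast
          then have "lab (d - 1) y t'" using yd 2 unfolding lab_def t'_def by (auto simp: minus_2_mod_3)
          then show False using lab_step[OF t z y] unfolding t'_def by fastforce
        qed
        then show ?thesis using y 2 unfolding lab_def t'_def by auto
      next
        case 3
        have "E z y"
        proof (rule ccontr)
          assume "\<not> E z y"
          then have yz: "E y z" using yz' by blast
          have "dominates_tri y t'"
            using yz yd y 3 unfolding dominates_tri_def t'_def lab_def
            by (subst all_3[where c = d]) auto
          moreover have "lab e (t e) t'"
            using cyc_nexts[OF t, of e] unfolding lab_def t'_def by auto
          moreover have "E (t e) y" using y 3 unfolding lab_def by auto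
          ultimately have "E (t e) (t' e)" using lab_two_out[OF t'] by blast
          then show False using zte asym unfolding t'_def by auto
        qed
        then show ?thesis using y 3 unfolding lab_def t'_def by auto
      qed
    qed
    ultimately show ?thesis using Suc.IH[of t'] False t' y0 by auto
  qed
qed

text \<open>The end \<open>x k\<close> has label \<open>e\<close> and comes to dominate the
  triangle, so the replaced corner is \<open>e - 1\<close>, the one that dominated
  \<open>x k\<close>. The removed vertex becomes the next element of the chain.\<close>

lemma chain_extend:
  assumes ch: "chain k x c t" and t: "cyc t" and y: "lab d y t"
    and dom: "\<And>j. j \<le> k \<Longrightarrow> dominates_tri (x j) (t(d := y))"
  shows "\<exists>x'. x' 0 = x 0 \<and> chain (Suc k) x' c (t(d := y))"
proof -
  define e where "e = c - of_nat k"
  have z: "lab e (x k) t" using ch unfolding chain_def e_def by blast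
  have "d = e - 1"
    using z dom[of k] asym unfolding lab_def dominates_tri_def by (metis fun_upd_other order_refl)
  then have d: "d = c - of_nat (Suc k)" unfolding e_def by simp
  define x' where "x' = x(Suc k := t d)"
  have "chain (Suc k) x' c (t(d := y))"
    unfolding chain_def d[symmetric]
  proof (intro conjI allI impI)
    fix j assume "j < Suc k"
    then show "dominates_tri (x' j) (t(d := y))" using dom[of j] unfolding x'_def by auto
    show "E (x' (Suc j)) (x' j)"
      using \<open>j < Suc k\<close> ch z \<open>d = e - 1\<close> unfolding x'_def chain_def lab_def
      by (cases "j = k") auto
  next
    fix j l assume "j + 2 \<le> l \<and> l \<le> Suc k"
    then show "E (x' j) (x' l)"
      using ch unfolding x'_def chain_def dominates_tri_def by (cases "l = Suc k") auto
  next
    show "lab d (x' (Suc k)) (t(d := y))"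
      using cyc_nexts[OF t, of d] unfolding x'_def lab_def by auto
  qed
  moreover have "x' 0 = x 0" unfolding x'_def by simp
  ultimately show ?thesis by blast
qed

text \<open>If some \<open>x j\<close> does not dominate \<open>y\<close>, the chain is cut at the
  least such \<open>j\<close>: by \<open>chain_back\<close> the vertex \<open>y\<close> enters
  exactly where it gives \<open>x j\<close> the label that the chain remembers. Otherwise only the
  end can change, and it either keeps its label or begins to dominate the triangle.\<close>

lemma chain_step:
  assumes ch: "chain k x c t" and k: "k \<ge> 1" and t: "cyc t" and y: "lab d y t"
  shows "\<exists>k' x'. x' 0 = x 0 \<and> chain k' x' c (t(d := y))"
proof (cases "\<exists>j<k. \<not> E (x j) y")
  case True
  define j where "j = (LEAST j. j < k \<and> \<not> E (x j) y)"
  have j: "j < k" "\<not> E (x j) y" using LeastI_ex[OF True] unfolding j_def by auto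
  have less: "E (x i) y" if "i < j" for i
    using not_less_Least[of i "\<lambda>j. j < k \<and> \<not> E (x j) y"] that j unfolding j_def by auto
  have dj: "dominates_tri (x j) t" using ch j unfolding chain_def by blast
  have "x j \<noteq> y" using dj y dominates_not_lab by blast
  then have yj: "E y (x j)" using j total y dj E_in unfolding lab_def dominates_tri_def by blast
  have "chain (k - j) (\<lambda>i. x (i + j)) (c - of_nat j) t" using chain_shift[OF ch] j by auto
  from chain_back[OF this _ t _ y] yj j have d: "d = c - of_nat j - 1" by auto
  then have d': "c - of_nat j = d + 1" by simp
  have "chain j x c (t(d := y))"
    unfolding chain_def
  proof (intro conjI allI impI)
    fix i assume "i < j"
    then show "dominates_tri (x i) (t(d := y))" using ch j less unfolding chain_def by (auto intro!: dominates_upd)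
  next
    show "lab (c - of_nat j) (x j) (t(d := y))"
      unfolding d' using dj yj unfolding lab_def dominates_tri_def by (auto simp: minus_2_mod_3)
  qed (use ch j in \<open>auto simp: chain_def\<close>)
  then show ?thesis by blast
next
  case False
  define e where "e = c - of_nat k"
  have z: "lab e (x k) t" using ch unfolding chain_def e_def by blast
  have dom: "dominates_tri (x j) (t(d := y))" if "j < k" for j
    using that False ch unfolding chain_def by (auto intro!: dominates_upd)
  have cyc': "cyc (t(d := y))" using cyc_upd t y by blast
  obtain i where i: "k = Suc i" using k by (cases k) auto
  have zi: "E (x k) (x i)" "dominates_tri (x i) t" using ch i unfolding chain_def by auto
  have zte: "E (x k) (t e)" using lab_two_out[OF t zi(2,1) z] .
  from lab_cases[OF cyc', of "x k"] zi E_in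
  consider "dominates_tri (x k) (t(d := y))" | "\<forall>i. E ((t(d := y)) i) (x k)" | c' where "lab c' (x k) (t(d := y))"
    by blast
  then show ?thesis
  proof cases
    case 1
    then show ?thesis using chain_extend[OF ch t y] dom by (metis le_neq_implies_less)
  next
    case 2
    \<comment> \<open>Both \<open>t e\<close> and \<open>t (e + 1)\<close> are dominated by
      \<open>x k\<close>, so each would have to be the replaced corner.\<close>
    have "d = e" using 2 zte asym by (metis fun_upd_other)
    moreover have "d = e + 1" using 2 z asym unfolding lab_def by (metis fun_upd_other)
    ultimately show ?thesis by simp
  next
    case 3
    then have "lab e (x k) (t(d := y))" using lab_step[OF t y z] by blast
    then have "chain k x c (t(d := y))" using ch dom unfolding chain_def e_def by blast
    then show ?thesis by blast
  qed
qed

end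

context U5_free_tournament
begin

text \<open>\<open>U5\<close> is isomorphic to its reversal, by exchanging \<open>a\<close> with
  \<open>b\<close> and \<open>c\<close> with \<open>e\<close>.\<close>

lemma dual: "U5_free_tournament V (\<lambda>x y. E y x)"
proof
  fix a b c d e show "\<not> U5_at (\<lambda>x y. E y x) a b c d e"
    using noU5[of b a e d c] unfolding U5_at_def by blast
qed (use finite_V E_in asym total in blast)+

lemma T5_dual: "U5_free_tournament.T5 (\<lambda>x y. E y x) a b c d e \<longleftrightarrow> T5 e d c b a"
  unfolding U5_free_tournament.T5_def[OF dual] T5_def by blast

end

section \<open>Triangle chains with numbered corners\<close>

context relational_tournament
begin

text \<open>Unlike \<open>con\<close> this has no rotation, so that the index of a corner keeps its
  meaning along the chain.\<close>

inductive reach :: "(3 \<Rightarrow> 'a) \<Rightarrow> (3 \<Rightarrow> 'a) \<Rightarrow> bool" for s where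
  reach_refl: "reach s s"
| reach_step: "reach s t \<Longrightarrow> lab d y t \<Longrightarrow> reach s (t(d := y))"

lemma reach_cyc: "reach s t \<Longrightarrow> cyc s \<Longrightarrow> cyc t"
  by (induction rule: reach.induct) (auto simp: cyc_upd)

lemma reach_trans: "reach s t \<Longrightarrow> reach r s \<Longrightarrow> reach r t"
  by (induction rule: reach.induct) (auto intro: reach.intros)

lemma reach_sym: "reach s t \<Longrightarrow> cyc s \<Longrightarrow> reach t s"
proof (induction rule: reach.induct)
  case reach_refl
  show ?case by (rule reach.reach_refl)
next
  case (reach_step t d y)
  have "cyc t" using reach_cyc reach_step by blast
  then have "lab d (t d) (t(d := y))" using lab_self[of t d] unfolding lab_def by auto
  from reach.reach_step[OF reach.reach_refl this] have "reach (t(d := y)) t" by simp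
  then show ?case using reach_trans reach_step by blast
qed

text \<open>The rotations of a \<open>con\<close> chain can be collected into a single offset
  \<open>r\<close>.\<close>

lemma con_reach:
  assumes "con (s 0) (s 1) (s 2) x y z"
  shows "\<exists>t r. reach s t \<and> x = t r \<and> y = t (r + 1) \<and> z = t (r - 1)"
  using assms
proof (induction rule: con.induct)
  case base
  have "(0::3) - 1 = 2" by simp
  then show ?case using reach_refl[of s] by (metis add_0)
next
  case (rot x y z)
  then obtain t r where "reach s t" "x = t r" "y = t (r + 1)" "z = t (r - 1)" by blast
  then show ?case by (intro exI[of _ t] exI[of _ "r + 1"]) (simp add: minus_2_mod_3)
next
  case (rep x y z w)
  then obtain t r where t: "reach s t" "x = t r" "y = t (r + 1)" "z = t (r - 1)" by blast
  then have "lab (r - 1) w t" using rep.hyps(2) unfolding lab_def Tri_def by (simp add: minus_2_mod_3)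
  then have "reach s (t(r - 1 := w))" using t reach_step by blast
  moreover have "(t(r - 1 := w)) r = x" "(t(r - 1 := w)) (r + 1) = y" "(t(r - 1 := w)) (r - 1) = w"
    using t by auto
  ultimately show ?case by metis
qed

end

context T5_U5_free_tournament
begin

lemma chain_0: "chain 0 x c t \<longleftrightarrow> lab c (x 0) t"
  unfolding chain_def by auto

text \<open>For a chain of length 0 there is one more outcome: the new triangle dominates
  \<open>x 0\<close>, and a chain in the reversed tournament has to take over.\<close>

lemma chain_step_0:
  assumes ch: "chain k x c t" and t: "cyc t" and y: "lab d y t"
  shows "(\<exists>k' x'. x' 0 = x 0 \<and> chain k' x' c (t(d := y))) \<or>
    (lab c (x 0) t \<and> (\<forall>i. E ((t(d := y)) i) (x 0)))"
proof (cases "k = 0")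
  case False
  then show ?thesis using chain_step[OF ch _ t y] by auto
next
  case True
  then have x: "lab c (x 0) t" using ch chain_0 by blast
  then have "x 0 \<in> V" using E_in unfolding lab_def by blast
  moreover have "cyc (t(d := y))" using cyc_upd t y by blast
  ultimately consider "dominates_tri (x 0) (t(d := y))" | "\<forall>i. E ((t(d := y)) i) (x 0)"
    | c' where "lab c' (x 0) (t(d := y))" using lab_cases by blast
  then show ?thesis
  proof cases
    case 1
    then show ?thesis using chain_extend[OF ch t y] True by auto
  next
    case 2
    then show ?thesis using x by blast
  next
    case 3
    then have "chain 0 x c (t(d := y))" using lab_step[OF t y x] unfolding chain_0 by blast
    then show ?thesis by blast
  qed
qed

lemma T5_U5_dual: "T5_U5_free_tournament V (\<lambda>x y. E y x)"
  using dual T5_dual noT5 unfolding T5_U5_free_tournament_def T5_U5_free_tournament_axioms_def by blast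

interpretation D: T5_U5_free_tournament V "\<lambda>x y. E y x"
  by (rule T5_U5_dual)

text \<open>The label that \<open>v\<close> retains even while it dominates the triangle (first
  case) or is dominated by it (second case). Reversing the arcs reverses the cyclic order, hence the
  negated indices.\<close>

definition labelled :: "3 \<Rightarrow> 'a \<Rightarrow> (3 \<Rightarrow> 'a) \<Rightarrow> bool" where
  "labelled c v t \<longleftrightarrow> (\<exists>k x. x 0 = v \<and> chain k x c t) \<or> (\<exists>k x. x 0 = v \<and> D.chain k x (- c) (\<lambda>i. t (- i)))"

lemma D_lab: "D.lab (- c) v (\<lambda>i. t (- i)) \<longleftrightarrow> lab c v t"
  unfolding D.lab_def lab_def by (auto simp: add.commute)

lemma D_upd: "(\<lambda>i. (t(d := y)) (- i)) = (\<lambda>i. t (- i))(- d := (y::'a))" for d :: 3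
  by (auto simp: fun_eq_iff)

lemma D_cyc: "cyc t \<Longrightarrow> D.cyc (\<lambda>i. t (- i))"
  unfolding cyc_def D.cyc_def
proof (intro allI)
  fix i :: 3 assume "\<forall>i. E (t i) (t (i + 1))"
  from this[rule_format, of "- i - 1"] show "E (t (- (i + 1))) (t (- i))" by (simp add: algebra_simps minus_diff_commute)
qed

lemma labelled_step:
  assumes l: "labelled c v t" and t: "cyc t" and y: "lab d y t"
  shows "labelled c v (t(d := y))"
proof -
  note Dt = D_cyc[OF t] and Dy = y[folded D_lab]
  from l consider k x where "x 0 = v" "chain k x c t"
    | k x where "x 0 = v" "D.chain k x (- c) (\<lambda>i. t (- i))" unfolding labelled_def by blast
  then show ?thesis
  proof cases
    case 1
    from chain_step_0[OF 1(2) t y] show ?thesis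
    proof (elim disjE conjE)
      \<comment> \<open>The current label is lost to domination by the triangle, so a chain of
        length 1 starts in the reversed tournament.\<close>
      assume l: "lab c (x 0) t" and dom: "\<forall>i. E ((t(d := y)) i) (x 0)"
      have "D.chain 0 x (- c) (\<lambda>i. t (- i))" unfolding D.chain_0 D_lab by (rule l)
      from D.chain_extend[OF this Dt Dy] dom have "\<exists>x'. x' 0 = x 0 \<and> D.chain (Suc 0) x' (- c) (\<lambda>i. (t(d := y)) (- i))"
        unfolding D.dominates_tri_def D_upd[symmetric] by auto
      then show ?thesis unfolding labelled_def using 1 by metis
    qed (use 1 in \<open>unfold labelled_def, metis\<close>)
  next
    case 2
    from D.chain_step_0[OF 2(2) Dt Dy] show ?thesis
      unfolding D_upd[symmetric]
    proof (elim disjE conjE)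
      assume l: "D.lab (- c) (x 0) (\<lambda>i. t (- i))" and dom: "\<forall>i. E (x 0) ((t(d := y)) (- i))"
      have "chain 0 x c t" using l unfolding chain_0 D_lab .
      moreover have "dominates_tri (x 0) (t(d := y))" unfolding dominates_tri_def using dom by (metis minus_minus)
      ultimately have "\<exists>x'. x' 0 = x 0 \<and> chain (Suc 0) x' c (t(d := y))"
        using chain_extend[OF _ t y] by auto
      then show ?thesis unfolding labelled_def using 2 by metis
    qed (use 2 in \<open>unfold labelled_def, metis\<close>)
  qed
qed

text \<open>A vertex with a current label neither dominates the triangle nor is dominated by it, so
  its chain has length 0 and the remembered label is the current one.\<close>

lemma labelled_lab:
  assumes "labelled c v t" "lab d v t"
  shows "c = d"
proof -
  have *: "k = 0" if "chain k x c t" "lab d (x 0) t" for k x c d t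
    using that dominates_not_lab unfolding chain_def by blast
  have D: "k = 0" if "D.chain k x c t" "D.lab d (x 0) t" for k x c d t
    using that D.dominates_not_lab unfolding D.chain_def by blast
  have d: "D.lab (- d) v (\<lambda>i. t (- i))" using assms(2) D_lab by blast
  show ?thesis using assms(1) unfolding labelled_def
  proof (elim disjE exE conjE)
    fix k x assume x: "x 0 = v" "chain k x c t"
    then have "lab c v t" using *[OF x(2)] assms(2) chain_0 by auto
    then show ?thesis using lab_unique assms(2) by blast
  next
    fix k x assume x: "x 0 = v" "D.chain k x (- c) (\<lambda>i. t (- i))"
    then have "D.lab (- c) v (\<lambda>i. t (- i))" using D[OF x(2)] d D.chain_0 by auto
    then show ?thesis using D.lab_unique[OF _ d] by fastforce
  qed
qed

lemma reach_labelled: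
  assumes "reach s t" "cyc s"
  shows "labelled c (s c) t"
  using assms
proof (induction rule: reach.induct)
  case reach_refl
  have "chain 0 (\<lambda>_. s c) c s" using lab_self reach_refl unfolding chain_0 by blast
  then show ?case unfolding labelled_def by (intro disjI1 exI conjI) auto
next
  case (reach_step t d y)
  then show ?case using labelled_step reach_cyc by blast
qed

text \<open>A vertex is coloured by the corner it occupies in the triangles reachable from
  \<open>s\<close>. By \<open>con_all\<close> every cyclic triangle is a rotation of a reachable
  one, whose corners have three different indices.\<close>

lemma rainbow_colouring:
  assumes ind: "indecomposable" and T: "Tri a b c"
  shows "\<exists>col :: 'a \<Rightarrow> 3. \<forall>x y z. Tri x y z \<longrightarrow> col x \<noteq> col y \<and> col y \<noteq> col z \<and> col x \<noteq> col z"
proof -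
  define s where "s = (\<lambda>i::3. if i = 0 then a else if i = 1 then b else c)"
  have s3: "s 0 = a" "s 1 = b" "s 2 = c" unfolding s_def by auto
  have s: "cyc s"
    using T unfolding cyc_iff[where c = 0] Tri_def s_def by auto
  \<comment> \<open>The colour is well defined: the corner \<open>t i\<close> keeps the label
    \<open>i\<close> on the way from \<open>t\<close> to \<open>t'\<close>, where it is the corner
    \<open>j\<close>.\<close>
  have uniq: "i = j" if "reach s t" "reach s t'" "t i = t' j" for t t' i j
  proof -
    have t: "cyc t" "cyc t'" using that reach_cyc s by blast+
    have "reach t t'" using that s reach_sym reach_trans by blast
    then have "labelled i (t i) t'" using reach_labelled t by blast
    moreover have "lab j (t i) t'" using lab_self t that by metis
    ultimately show ?thesis by (rule labelled_lab)
  qed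
  define col where "col x = (THE i. \<exists>t. reach s t \<and> t i = x)" for x
  have col: "col (t i) = i" if "reach s t" for t i
    unfolding col_def using uniq that by blast
  have "col x \<noteq> col y \<and> col y \<noteq> col z \<and> col x \<noteq> col z" if xyz: "Tri x y z" for x y z
  proof -
    obtain t r where "reach s t" "x = t r" "y = t (r + 1)" "z = t (r - 1)"
      using con_reach con_all[OF ind T xyz] s3 by metis
    then show ?thesis using col by auto
  qed
  then show ?thesis by blast
qed

end

section \<open>The weighted inequality\<close>

lemma log_2_3: "2 powr (log 2 3) = (3::real)" "log 2 3 \<ge> (3/2::real)"
proof -
  show "2 powr (log 2 3) = (3::real)" by simp
  have "2 powr (3/2) = (2::real) powr (1 + 1/2)" by simp
  also have "\<dots> = 2 * sqrt 2" by (subst powr_add) (simp add: powr_half_sqrt)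
  also have "\<dots> \<le> 3" by (rule power2_le_imp_le) (auto simp: power_mult_distrib)
  finally have "2 powr (3/2) \<le> (3::real)" .
  then show "log 2 3 \<ge> (3/2::real)" by (subst le_log_iff) auto
qed

abbreviation \<alpha> :: real where "\<alpha> \<equiv> log 2 3"

text \<open>This determines the exponent: three weights \<open>M/2\<close> just reach the bound
  \<open>M powr \<alpha>\<close>.\<close>

lemma half_powr: "M \<ge> 0 \<Longrightarrow> (M/2) powr \<alpha> = M powr \<alpha> / 3"
  by (simp add: powr_divide log_2_3)

lemma sum_powr_le:
  fixes w :: "'a \<Rightarrow> real"
  assumes "\<And>v. v \<in> A \<Longrightarrow> 0 \<le> w v \<and> w v \<le> m"
  shows "(\<Sum>v\<in>A. w v powr \<alpha>) \<le> m powr (\<alpha> - 1) * sum w A"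
proof -
  have "w v powr \<alpha> \<le> m powr (\<alpha> - 1) * w v" if "v \<in> A" for v
  proof -
    have "w v powr \<alpha> = w v powr (\<alpha> - 1) * w v"
      using powr_mult_base[of "w v" "\<alpha> - 1"] assms[OF that] by (simp add: mult.commute)
    also have "\<dots> \<le> m powr (\<alpha> - 1) * w v"
      using assms[OF that] log_2_3(2) by (intro mult_right_mono powr_mono2) auto
    finally show ?thesis .
  qed
  then show ?thesis unfolding sum_distrib_left by (intro sum_mono)
qed

lemma sum_powr_superadd:
  fixes w :: "'a \<Rightarrow> real"
  assumes "finite A" "\<And>v. v \<in> A \<Longrightarrow> 0 \<le> w v"
  shows "(\<Sum>v\<in>A. w v powr \<alpha>) \<le> sum w A powr \<alpha>"
proof -
  have "(\<Sum>v\<in>A. w v powr \<alpha>) \<le> sum w A powr (\<alpha> - 1) * sum w A"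
    using assms by (intro sum_powr_le) (auto intro: member_le_sum)
  also have "\<dots> = sum w A powr \<alpha>"
    using powr_mult_base[of "sum w A" "\<alpha> - 1"] assms by (simp add: mult.commute sum_nonneg)
  finally show ?thesis .
qed

text \<open>If \<open>x \<le> M/2\<close>, each term is at most a third of the bound. Otherwise
  \<open>x\<close> is a convex combination of \<open>M\<close> and \<open>M/2\<close> with
  coefficients \<open>l\<close> and \<open>1 - l\<close>; convexity bounds its power, and
  \<open>y\<close> and \<open>z\<close> are at most \<open>(1 - l) * (M/2)\<close>. The three bounds
  add up to exactly \<open>M powr \<alpha>\<close>.\<close>

lemma three_powr_aux:
  assumes "0 \<le> y" "0 \<le> z" "y \<le> x" "z \<le> x" "x + y \<le> M" "x + z \<le> M"
  shows "x powr \<alpha> + y powr \<alpha> + z powr \<alpha> \<le> M powr \<alpha>"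
proof -
  have M: "0 \<le> M" using assms by linarith
  have half: "u powr \<alpha> \<le> M powr \<alpha> / 3" if "0 \<le> u" "u \<le> M/2" for u
    using powr_mono2[OF _ that(1,2), of \<alpha>] half_powr[OF M] log_2_3(2) by simp
  show ?thesis
  proof (cases "x \<le> M/2")
    case True
    then show ?thesis using half[of x] half[of y] half[of z] assms by linarith
  next
    case False
    define l where "l = 2 * x / M - 1"
    have M0: "M > 0" and x0: "x > 0" using False assms by linarith+
    have l: "0 \<le> l" "l \<le> 1" using False M0 assms unfolding l_def by (auto simp: field_simps)
    have x: "x = l * M + (1 - l) * (M/2)" using M0 unfolding l_def by (simp add: field_simps)
    have cx: "convex_on {0<..} (\<lambda>x::real. x powr \<alpha>)" using log_2_3(2) by (intro powr_convex) linarith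
    have "x powr \<alpha> \<le> l * M powr \<alpha> + (1 - l) * (M/2) powr \<alpha>"
      using convex_onD[OF cx, of "1 - l" M "M/2"] l M0 unfolding x by simp
    moreover have "u powr \<alpha> \<le> (1 - l) * (M/2) powr \<alpha>" if "0 \<le> u" "x + u \<le> M" for u
    proof -
      have "u \<le> (1 - l) * (M/2)" using that x by (simp add: field_simps)
      then have "u powr \<alpha> \<le> ((1 - l) * (M/2)) powr \<alpha>" using that log_2_3(2) by (intro powr_mono2) auto
      also have "\<dots> = (1 - l) powr \<alpha> * (M/2) powr \<alpha>" by (rule powr_mult)
      also have "(1 - l) powr \<alpha> \<le> (1 - l) powr 1" using l log_2_3(2) by (intro powr_mono') auto
      finally show ?thesis using l by (simp add: mult_right_mono)
    qed
    from this[of y] this[of z] have "y powr \<alpha> + z powr \<alpha> \<le> 2 * (1 - l) * (M powr \<alpha> / 3)"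
      using assms half_powr[OF M] by (simp add: algebra_simps)
    ultimately show ?thesis using half_powr[OF M] by (simp add: field_simps)
  qed
qed

lemma three_powr:
  assumes "0 \<le> x" "0 \<le> y" "0 \<le> z" "x + y \<le> M" "y + z \<le> M" "x + z \<le> M"
  shows "x powr \<alpha> + y powr \<alpha> + z powr \<alpha> \<le> M powr \<alpha>"
proof -
  consider "y \<le> x" "z \<le> x" | "x \<le> y" "z \<le> y" | "x \<le> z" "y \<le> z" by linarith
  then show ?thesis
  proof cases
    case 1 then show ?thesis using three_powr_aux[of y z x M] assms by linarith
  next
    case 2 then show ?thesis using three_powr_aux[of x z y M] assms by linarith
  next
    case 3 then show ?thesis using three_powr_aux[of x y z M] assms by linarith
  qed
qed

text \<open>As \<open>\<alpha> - 1\<close> is at least 1/2, the power of \<open>2 * m / M\<close>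
  may be replaced by its square root \<open>s\<close>. What remains is a cubic inequality in
  \<open>s\<close>, equivalent to \<open>0 \<le> (1 - s) * (3 - s - s^2)\<close>.\<close>

lemma small_powr:
  assumes m: "0 < m" "m \<le> M/2"
  shows "m powr (\<alpha> - 1) * (2 * M - m) \<le> M powr \<alpha>"
proof -
  define s where "s = sqrt (2 * m / M)"
  have M: "M > 0" using m by linarith
  have s: "0 \<le> s" "s \<le> 1" "s\<^sup>2 = 2 * m / M" using m M unfolding s_def by auto
  have "m powr (\<alpha> - 1) = ((2 * m / M) * (M/2)) powr (\<alpha> - 1)" using M by simp
  also have "\<dots> = (2 * m / M) powr (\<alpha> - 1) * (M/2) powr (\<alpha> - 1)" by (rule powr_mult)
  also have "(2 * m / M) powr (\<alpha> - 1) \<le> (2 * m / M) powr (1/2)"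
    using m M log_2_3(2) by (intro powr_mono') (auto simp: field_simps)
  also have "(2 * m / M) powr (1/2) = s" unfolding s_def using m M by (simp add: powr_half_sqrt)
  also have "(M/2) powr (\<alpha> - 1) = (M/2) powr \<alpha> / (M/2)" using M by (simp add: powr_diff)
  also have "\<dots> = 2/3 * M powr \<alpha> / M" unfolding half_powr[OF less_imp_le[OF M]] by simp
  finally have 1: "m powr (\<alpha> - 1) \<le> s * (2/3 * M powr \<alpha> / M)" by (simp add: mult_right_mono)
  have 2: "2 * M - m = M * (2 - s\<^sup>2 / 2)" using M unfolding s by (simp add: field_simps)
  have "m powr (\<alpha> - 1) * (2 * M - m) \<le> s * (2/3 * M powr \<alpha> / M) * (2 * M - m)"
    using 1 m M by (intro mult_right_mono) auto
  also have "\<dots> = M powr \<alpha> * (2/3 * s * (2 - s\<^sup>2 / 2))" unfolding 2 using M by (simp add: field_simps)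
  also have "\<dots> \<le> M powr \<alpha> * 1"
  proof (rule mult_left_mono)
    have "s * s \<le> s * 1" using s(1,2) by (intro mult_left_mono)
    then have "s\<^sup>2 \<le> s" by (simp add: power2_eq_square)
    then have "0 \<le> (1 - s) * (3 - s - s\<^sup>2)" using s by (intro mult_nonneg_nonneg) linarith+
    then show "2/3 * s * (2 - s\<^sup>2 / 2) \<le> 1" by (simp add: algebra_simps power2_eq_square)
  qed simp
  finally show ?thesis by simp
qed

section \<open>The weighted inequality for indecomposable tournaments\<close>

definition triangle_free_on :: "('a \<Rightarrow> 'a \<Rightarrow> bool) \<Rightarrow> 'a set \<Rightarrow> bool" where
  "triangle_free_on E S \<longleftrightarrow> (\<forall>a\<in>S. \<forall>b\<in>S. \<forall>c\<in>S. \<not> (E a b \<and> E b c \<and> E c a))"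

lemma triangle_free_onD: "triangle_free_on E S \<Longrightarrow> a \<in> S \<Longrightarrow> b \<in> S \<Longrightarrow> c \<in> S \<Longrightarrow> \<not> (E a b \<and> E b c \<and> E c a)"
  unfolding triangle_free_on_def by blast

context relational_tournament
begin

text \<open>A cyclic triangle needs all three colours, so any two classes together weigh at most
  \<open>M\<close>. Superadditivity handles each class and \<open>three_powr\<close> combines
  them.\<close>

lemma weighted_rainbow:
  fixes w :: "'a \<Rightarrow> real" and col :: "'a \<Rightarrow> 3"
  assumes w: "\<And>v. v \<in> V \<Longrightarrow> w v \<ge> 0"
    and M: "\<And>S. S \<subseteq> V \<Longrightarrow> triangle_free_on E S \<Longrightarrow> sum w S \<le> M"
    and col: "\<And>x y z. Tri x y z \<Longrightarrow> col x \<noteq> col y \<and> col y \<noteq> col z \<and> col x \<noteq> col z"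
  shows "(\<Sum>v\<in>V. w v powr \<alpha>) \<le> M powr \<alpha>"
proof -
  define X where "X i = {v \<in> V. col v = i}" for i
  have fin: "finite (X i)" for i unfolding X_def using finite_V by auto
  have dis: "X i \<inter> X j = {}" if "i \<noteq> j" for i j unfolding X_def using that by auto
  have V: "V = X 0 \<union> X 1 \<union> X 2"
  proof -
    have "c = 0 \<or> c = 1 \<or> c = 2" for c :: 3 using cases_mod_3[of c 0] by auto
    then show ?thesis unfolding X_def by blast
  qed
  have pair: "sum w (X i) + sum w (X j) \<le> M" if "i \<noteq> j" for i j
  proof -
    have "triangle_free_on E (X i \<union> X j)"
      unfolding triangle_free_on_def
    proof (intro ballI notI)
      fix a b c assume "a \<in> X i \<union> X j" "b \<in> X i \<union> X j" "c \<in> X i \<union> X j" "E a b \<and> E b c \<and> E c a"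
      then show False using col[of a b c] unfolding X_def Tri_def by auto
    qed
    then have "sum w (X i \<union> X j) \<le> M" using M unfolding X_def by auto
    then show ?thesis using sum.union_disjoint[OF fin fin dis[OF that]] by metis
  qed
  have split: "sum f V = sum f (X 0) + sum f (X 1) + sum f (X 2)" for f :: "'a \<Rightarrow> real"
  proof -
    have "(X 0 \<union> X 1) \<inter> X 2 = {}" using dis[of 0 2] dis[of 1 2] by auto
    then show ?thesis unfolding V using fin dis[of 0 1] by (simp add: sum.union_disjoint)
  qed
  have Xi: "(\<Sum>v\<in>X i. w v powr \<alpha>) \<le> sum w (X i) powr \<alpha>" "sum w (X i) \<ge> 0" for i
    using sum_powr_superadd[OF fin, of i w] w unfolding X_def by (auto intro: sum_nonneg)
  have "sum w (X 0) powr \<alpha> + sum w (X 1) powr \<alpha> + sum w (X 2) powr \<alpha> \<le> M powr \<alpha>"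
    using Xi pair[of 0 1] pair[of 1 2] pair[of 0 2] by (intro three_powr) auto
  then show ?thesis unfolding split using Xi[of 0] Xi[of 1] Xi[of 2] by linarith
qed

text \<open>Let \<open>v\<close> have maximal weight. With its out-neighbours \<open>A\<close>, and
  likewise with its in-neighbours \<open>B\<close>, it forms a triangle-free set, so the total
  weight is at most \<open>2 * M - w v\<close>. A light \<open>v\<close> is settled by
  \<open>small_powr\<close>, as all weights are at most \<open>w v\<close>; a heavy one by
  \<open>three_powr\<close>.\<close>

lemma weighted_locally_transitive:
  fixes w :: "'a \<Rightarrow> real"
  assumes w: "\<And>v. v \<in> V \<Longrightarrow> w v \<ge> 0"
    and M: "\<And>S. S \<subseteq> V \<Longrightarrow> triangle_free_on E S \<Longrightarrow> sum w S \<le> M"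
    and out: "\<And>v x y z. Tri x y z \<Longrightarrow> E v x \<Longrightarrow> E v y \<Longrightarrow> E v z \<Longrightarrow> False"
    and inn: "\<And>v x y z. Tri x y z \<Longrightarrow> E x v \<Longrightarrow> E y v \<Longrightarrow> E z v \<Longrightarrow> False"
  shows "(\<Sum>v\<in>V. w v powr \<alpha>) \<le> M powr \<alpha>"
proof (cases "V = {}")
  case True
  then show ?thesis by simp
next
  case False
  have "Max (w ` V) \<in> w ` V" using False finite_V by (intro Max_in) auto
  then obtain v where v: "v \<in> V" and max: "Max (w ` V) = w v" by auto
  have wv: "w u \<le> w v" if "u \<in> V" for u unfolding max[symmetric] using that finite_V by (intro Max_ge) auto
  define A where "A = {u. E v u}"
  define B where "B = {u. E u v}"
  have AB: "A \<subseteq> V" "B \<subseteq> V" unfolding A_def B_def using E_in by auto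
  have fin: "finite A" "finite B" using AB finite_V finite_subset by auto
  have dis: "v \<notin> A" "v \<notin> B" "A \<inter> B = {}" unfolding A_def B_def using irrefl asym by auto
  have V: "V = insert v (A \<union> B)" using AB v total unfolding A_def B_def by auto
  have split: "sum f V = f v + sum f A + sum f B" for f :: "'a \<Rightarrow> real"
    unfolding V using fin dis by (simp add: sum.union_disjoint)
  have "triangle_free_on E (insert v A)"
    unfolding triangle_free_on_def A_def
    using out[of _ _ _ v, unfolded Tri_def] asym irrefl by blast
  then have "sum w (insert v A) \<le> M" using M v AB by auto
  then have MA: "w v + sum w A \<le> M" using fin dis by simp
  have "triangle_free_on E (insert v B)"
    unfolding triangle_free_on_def B_def
    using inn[of _ _ _ v, unfolded Tri_def] asym irrefl by blast
  then have "sum w (insert v B) \<le> M" using M v AB by auto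
  then have MB: "w v + sum w B \<le> M" using fin dis by simp
  have nn: "0 \<le> w v" "0 \<le> sum w A" "0 \<le> sum w B" using w v AB by (auto intro!: sum_nonneg)
  show ?thesis
  proof (cases "w v \<le> M / 2")
    case True
    show ?thesis
    proof (cases "w v = 0")
      case True
      then have "w u = 0" if "u \<in> V" for u using wv[OF that] w[OF that] True by linarith
      then show ?thesis by simp
    next
      case False
      have "(\<Sum>u\<in>V. w u powr \<alpha>) \<le> w v powr (\<alpha> - 1) * sum w V"
        using wv w by (intro sum_powr_le) auto
      also have "\<dots> \<le> w v powr (\<alpha> - 1) * (2 * M - w v)"
        using MA MB unfolding split by (intro mult_left_mono) auto
      also have "\<dots> \<le> M powr \<alpha>" using False True nn by (intro small_powr) auto
      finally show ?thesis .
    qed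
  next
    case False
    have "(\<Sum>u\<in>A. w u powr \<alpha>) \<le> sum w A powr \<alpha>" "(\<Sum>u\<in>B. w u powr \<alpha>) \<le> sum w B powr \<alpha>"
      by (intro sum_powr_superadd fin, use w AB in blast)+
    \<comment> \<open>As \<open>w v\<close> exceeds \<open>M/2\<close>, the weights of
      \<open>A\<close> and \<open>B\<close> are below \<open>M/2\<close>, which supplies the third
      pair bound.\<close>
    moreover have "w v powr \<alpha> + sum w A powr \<alpha> + sum w B powr \<alpha> \<le> M powr \<alpha>"
      using False MA MB nn by (intro three_powr) auto
    ultimately show ?thesis unfolding split by linarith
  qed
qed

end

context U5_free_tournament
begin

lemma weighted_indecomposable:
  fixes w :: "'a \<Rightarrow> real"
  assumes ind: "indecomposable"
    and w: "\<And>v. v \<in> V \<Longrightarrow> w v \<ge> 0"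
    and M: "\<And>S. S \<subseteq> V \<Longrightarrow> triangle_free_on E S \<Longrightarrow> sum w S \<le> M"
  shows "(\<Sum>v\<in>V. w v powr \<alpha>) \<le> M powr \<alpha>"
proof (cases "\<exists>a b c d e. T5 a b c d e")
  case True
  then obtain a b c d e where T: "T5 a b c d e" by blast
  interpret D: U5_free_tournament V "\<lambda>x y. E y x" by (rule dual)
  have ind': "D.indecomposable"
    using ind unfolding D.indecomposable_def indecomposable_def D.homogeneous_def homogeneous_def
    by (simp add: disj_commute)
  have T': "D.T5 e d c b a" using T T5_dual by blast
  show ?thesis
  proof (rule weighted_locally_transitive[OF w M])
    show "Tri x y z \<Longrightarrow> E v x \<Longrightarrow> E v y \<Longrightarrow> E v z \<Longrightarrow> False" for v x y z
      using no_dominated_triangle[OF ind T] .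
    show "Tri x y z \<Longrightarrow> E x v \<Longrightarrow> E y v \<Longrightarrow> E z v \<Longrightarrow> False" for v x y z
      using D.no_dominated_triangle[OF ind' T', of z y x v] unfolding D.Tri_def Tri_def by blast
  qed
next
  case False
  then interpret T5_U5_free_tournament V E by unfold_locales blast
  have "\<exists>col :: 'a \<Rightarrow> 3. \<forall>x y z. Tri x y z \<longrightarrow> col x \<noteq> col y \<and> col y \<noteq> col z \<and> col x \<noteq> col z"
    using rainbow_colouring[OF ind] by blast
  then show ?thesis using weighted_rainbow[OF w M] by blast
qed

lemma restrict:
  assumes A: "A \<subseteq> V"
  shows "U5_free_tournament A (\<lambda>x y. E x y \<and> x \<in> A \<and> y \<in> A)"
proof
  show "finite A" using A finite_V finite_subset by blast
  show "E x y \<and> x \<in> A \<and> y \<in> A \<or> E y x \<and> y \<in> A \<and> x \<in> A" if "x \<in> A" "y \<in> A" "x \<noteq> y" for x y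
    using total A that by blast
  show "\<not> U5_at (\<lambda>x y. E x y \<and> x \<in> A \<and> y \<in> A) a b c d e" for a b c d e
    using noU5[of a b c d e] unfolding U5_at_def by blast
qed (use asym in auto)

end

section \<open>Contraction of homogeneous sets\<close>

lemma triangle_free_on_restrict:
  "S \<subseteq> A \<Longrightarrow> triangle_free_on (\<lambda>x y. E x y \<and> x \<in> A \<and> y \<in> A) S \<longleftrightarrow> triangle_free_on E S"
  unfolding triangle_free_on_def by blast

text \<open>Induction on the number of vertices. A proper homogeneous set \<open>M\<close> is solved
  by itself and contracted to a vertex \<open>m\<close> that carries the weight of its solution
  \<open>S1\<close>. In the solution \<open>S2\<close> of the contracted tournament,
  \<open>m\<close> is then expanded to \<open>S1\<close>.\<close>

theorem U5_free_weighted: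
  fixes w :: "'a \<Rightarrow> real"
  assumes "U5_free_tournament V E" "\<And>v. v \<in> V \<Longrightarrow> w v \<ge> 0"
  shows "\<exists>S\<subseteq>V. triangle_free_on E S \<and> (\<Sum>v\<in>V. w v powr \<alpha>) \<le> sum w S powr \<alpha>"
  using assms
proof (induction "card V" arbitrary: V E w rule: less_induct)
  case less
  interpret U5_free_tournament V E by (rule less.prems)
  have IH: "\<exists>S\<subseteq>A. triangle_free_on E S \<and> (\<Sum>v\<in>A. w' v powr \<alpha>) \<le> sum w' S powr \<alpha>"
    if A: "A \<subset> V" and w': "\<And>v. v \<in> A \<Longrightarrow> w' v \<ge> 0" for A and w' :: "'a \<Rightarrow> real"
  proof -
    have "card A < card V" using A finite_V psubset_card_mono by blast
    from less.hyps[OF this restrict, of w'] A w'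
    obtain S where "S \<subseteq> A" "triangle_free_on (\<lambda>x y. E x y \<and> x \<in> A \<and> y \<in> A) S"
      "(\<Sum>v\<in>A. w' v powr \<alpha>) \<le> sum w' S powr \<alpha>" by auto
    then show ?thesis using triangle_free_on_restrict[of S A E] by auto
  qed
  show ?case
  proof (cases indecomposable)
    case True
    define \<F> where "\<F> = {S. S \<subseteq> V \<and> triangle_free_on E S}"
    have "finite \<F>" unfolding \<F>_def using finite_V by auto
    moreover have "{} \<in> \<F>" unfolding \<F>_def triangle_free_on_def by auto
    ultimately have "Max (sum w ` \<F>) \<in> sum w ` \<F>" by (intro Max_in) auto
    then obtain S where S: "S \<in> \<F>" and max: "Max (sum w ` \<F>) = sum w S" by auto
    have "sum w S' \<le> sum w S" if "S' \<in> \<F>" for S'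
      unfolding max[symmetric] using that \<open>finite \<F>\<close> by (intro Max_ge) auto
    then have "(\<Sum>v\<in>V. w v powr \<alpha>) \<le> sum w S powr \<alpha>"
      unfolding \<F>_def by (intro weighted_indecomposable[OF True]) (auto intro: less.prems)
    then show ?thesis using S unfolding \<F>_def by auto
  next
    case False
    then obtain M where M: "homogeneous M" "card M > 1" "M \<noteq> V"
      unfolding indecomposable_def by (auto simp: not_le)
    then have MV: "M \<subset> V" unfolding homogeneous_def by auto
    have finM: "finite M" using MV finite_V finite_subset by blast
    obtain S1 where S1: "S1 \<subseteq> M" "triangle_free_on E S1" "(\<Sum>v\<in>M. w v powr \<alpha>) \<le> sum w S1 powr \<alpha>"
      using IH[OF MV, of w] less.prems(2) MV by (meson psubsetD)
    have "M \<noteq> {}" using M(2) by auto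
    then obtain m where m: "m \<in> M" by blast
    define A where "A = insert m (V - M)"
    define w' where "w' = w(m := sum w S1)"
    have "A \<noteq> V"
    proof
      assume "A = V"
      then have "M \<subseteq> {m}" using MV unfolding A_def by auto
      then have "card M \<le> card {m}" by (intro card_mono) auto
      then show False using M(2) by simp
    qed
    then have AV: "A \<subset> V" using m MV unfolding A_def by auto
    have w1: "sum w S1 \<ge> 0"
      by (rule sum_nonneg) (use S1(1) MV less.prems(2) in blast)
    have w'0: "w' v \<ge> 0" if "v \<in> A" for v
    proof (cases "v = m")
      case False
      then show ?thesis using less.prems(2)[of v] AV that unfolding w'_def by auto
    qed (simp add: w'_def w1)
    obtain S2 where S2: "S2 \<subseteq> A" "triangle_free_on E S2"
      "(\<Sum>v\<in>A. w' v powr \<alpha>) \<le> sum w' S2 powr \<alpha>"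
      using IH[OF AV, of w'] w'0 by blast
    have "finite A" using AV finite_V by (metis finite_subset psubset_imp_subset)
    then have finS: "finite S2" "finite S1"
      using finite_subset[OF S2(1)] finite_subset[OF S1(1) finM] by blast+
    have "(\<Sum>v\<in>V. w v powr \<alpha>) = (\<Sum>v\<in>M. w v powr \<alpha>) + (\<Sum>v\<in>V - M. w v powr \<alpha>)"
      using MV finite_V by (metis add.commute psubset_imp_subset sum.subset_diff)
    also have "\<dots> \<le> (\<Sum>v\<in>A. w' v powr \<alpha>)"
    proof -
      have "(\<Sum>v\<in>V - M. w' v powr \<alpha>) = (\<Sum>v\<in>V - M. w v powr \<alpha>)"
        unfolding w'_def using m by (intro sum.cong) auto
      then show ?thesis unfolding A_def using S1(3) m finite_V by (simp add: w'_def)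
    qed
    also note S2(3)
    finally have le: "(\<Sum>v\<in>V. w v powr \<alpha>) \<le> sum w' S2 powr \<alpha>" .
    show ?thesis
    proof (cases "m \<in> S2")
      case False
      then have "sum w' S2 = sum w S2" unfolding w'_def by (intro sum.cong) auto
      then show ?thesis using le S2 AV by (intro exI[of _ S2]) auto
    next
      case True
      define S where "S = (S2 - {m}) \<union> S1"
      have S2M: "S2 - {m} \<subseteq> V - M" using S2(1) unfolding A_def by auto
      have "sum w S = sum w (S2 - {m}) + sum w S1"
        unfolding S_def using finS S2M S1(1) by (intro sum.union_disjoint) auto
      moreover have "sum w' S2 = sum w S1 + sum w (S2 - {m})"
        using True finS by (simp add: sum.remove w'_def)
      ultimately have sums: "sum w S = sum w' S2" by simp
      \<comment> \<open>Collapsing \<open>S1\<close> to \<open>m\<close> maps \<open>S\<close> into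
        \<open>S2\<close> and, by homogeneity, preserves all arcs except those inside
        \<open>S1\<close>.\<close>
      define \<pi> where "\<pi> x = (if x \<in> S1 then m else x)" for x
      have \<pi>: "\<pi> x \<in> S2" if "x \<in> S" for x using that True unfolding \<pi>_def S_def by auto
      have \<pi>_E: "E (\<pi> x) (\<pi> y)" if xy: "x \<in> S" "y \<in> S" "E x y" "\<not> (x \<in> S1 \<and> y \<in> S1)" for x y
      proof -
        have hom: "(\<forall>m\<in>M. E v m) \<or> (\<forall>m\<in>M. E m v)" if "v \<in> S" "v \<notin> S1" for v
          using that M(1) S2M unfolding S_def homogeneous_def by blast
        show ?thesis
        proof (cases "x \<in> S1 \<or> y \<in> S1")
          case True
          then show ?thesis
            using xy hom[of x] hom[of y] m S1(1) asym[OF xy(3)] unfolding \<pi>_def by auto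
        next
          case False
          then show ?thesis using xy unfolding \<pi>_def by auto
        qed
      qed
      have tf: "triangle_free_on E S"
        unfolding triangle_free_on_def
      proof (intro ballI notI)
        fix a b c assume abc: "a \<in> S" "b \<in> S" "c \<in> S" and T: "E a b \<and> E b c \<and> E c a"
        \<comment> \<open>A vertex outside \<open>S1\<close> cannot be dominated by one vertex of
          \<open>S1\<close> and dominate another.\<close>
        have two: False if "x \<in> S1" "y \<in> S1" "z \<notin> S1" "z \<in> S" "x \<in> S" "y \<in> S" "E y z" "E z x" for x y z
          using \<pi>_E[of y z] \<pi>_E[of z x] that asym unfolding \<pi>_def by auto
        show False
        proof (cases "a \<in> S1 \<and> b \<in> S1 \<or> b \<in> S1 \<and> c \<in> S1 \<or> c \<in> S1 \<and> a \<in> S1")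
          case True
          then have "a \<in> S1 \<and> b \<in> S1 \<and> c \<in> S1"
            using two[of a b c] two[of b c a] two[of c a b] abc T by blast
          then show ?thesis using triangle_free_onD[OF S1(2)] T by blast
        next
          case False
          then have "E (\<pi> a) (\<pi> b)" "E (\<pi> b) (\<pi> c)" "E (\<pi> c) (\<pi> a)"
            using \<pi>_E abc T by blast+
          then show ?thesis using triangle_free_onD[OF S2(2)] \<pi> abc by blast
        qed
      qed
      have "S \<subseteq> V" unfolding S_def using S2M S1(1) MV by auto
      then show ?thesis using tf le sums by metis
    qed
  qed
qed

text \<open>Unit weights, and \<open>log 3 2\<close> is the reciprocal of \<alpha>.\<close>

lemma U5_free_card:
  assumes "U5_free_tournament V E"
  shows "\<exists>S\<subseteq>V. triangle_free_on E S \<and> real (card V) powr log 3 2 \<le> real (card S)"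
proof -
  obtain S where S: "S \<subseteq> V" "triangle_free_on E S" "(\<Sum>v\<in>V. (1::real) powr \<alpha>) \<le> (\<Sum>v\<in>S. 1) powr \<alpha>"
    using U5_free_weighted[OF assms, of "\<lambda>_. 1"] by auto
  then have "real (card V) \<le> real (card S) powr \<alpha>" by simp
  then have "real (card V) powr log 3 2 \<le> (real (card S) powr \<alpha>) powr log 3 2"
    by (intro powr_mono2) auto
  also have "\<dots> = real (card S) powr (log 2 3 * log 3 2)" by (rule powr_powr)
  also have "log 2 3 * log 3 2 = (1::real)" by (simp add: log_def)
  finally show ?thesis using S by auto
qed

section \<open>Digraphs\<close>

lemma is_transitive_restrict:
  assumes "S \<subseteq> verts G"
  shows "is_transitive (G \<restriction> S) \<longleftrightarrow> triangle_free_on (dominates G) S"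
proof -
  have *: "u \<rightarrow>\<^bsub>G \<restriction> S\<^esub> v \<longleftrightarrow> u \<in> S \<and> v \<in> S \<and> u \<rightarrow>\<^bsub>G\<^esub> v" for u v
    unfolding arcs_ends_conv by (auto simp: image_iff)
  show ?thesis unfolding is_transitive_def triangle_free_on_def * by blast
qed

text \<open>The isomorphism numbers the five vertices in order. Arcs of \<open>U5\<close> are pairs,
  so an arc of \<open>G\<close> goes to the numbers of its ends; this is injective as there are no
  parallel arcs.\<close>

lemma (in tournament) U5_at_not_free:
  assumes U: "U5_at (dominates G) a b c d e"
  shows "\<not> is_free_of G U5"
proof -
  define S where "S = {a, b, c, d, e}"
  have irr: "\<not> x \<rightarrow>\<^bsub>G\<^esub> x" for x using no_loops by (auto simp: arcs_ends_conv)
  have as: "\<not> y \<rightarrow>\<^bsub>G\<^esub> x" if "x \<rightarrow>\<^bsub>G\<^esub> y" for x y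
    using that exactly_one_direction[of x y] irr[of x] adj_in_verts[OF that] by (cases "x = y") auto
  have U': "b \<rightarrow>\<^bsub>G\<^esub> a" "a \<rightarrow>\<^bsub>G\<^esub> c" "b \<rightarrow>\<^bsub>G\<^esub> c" "b \<rightarrow>\<^bsub>G\<^esub> d" "c \<rightarrow>\<^bsub>G\<^esub> d"
    "c \<rightarrow>\<^bsub>G\<^esub> e" "d \<rightarrow>\<^bsub>G\<^esub> e" "d \<rightarrow>\<^bsub>G\<^esub> a" "e \<rightarrow>\<^bsub>G\<^esub> a" "e \<rightarrow>\<^bsub>G\<^esub> b"
    using U unfolding U5_at_def by simp_all
  note neg = U'[THEN as]
  have neq: "x \<noteq> y" if "x \<rightarrow>\<^bsub>G\<^esub> y" for x y using that irr[of x] by auto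
  note ne = U'[THEN neq]
  have SV: "S \<subseteq> verts G" unfolding S_def using U'[THEN adj_in_verts(1)] by simp
  define f :: "'a \<Rightarrow> int" where
    "f x = (if x = a then 1 else if x = b then 2 else if x = c then 3 else if x = d then 4 else 5)" for x
  have f: "f a = 1" "f b = 2" "f c = 3" "f d = 4" "f e = 5"
    unfolding f_def by (simp_all add: ne ne[symmetric])
  define h where "h = \<lparr>iso_verts = f, iso_arcs = (\<lambda>x. (f (tail G x), f (head G x))),
    iso_head = snd, iso_tail = fst\<rparr>"
  have inj: "inj_on f S" unfolding S_def inj_on_def by (simp add: f)
  have ends: "arcs_ends (G \<restriction> S) = {(b,a), (a,c), (b,c), (b,d), (c,d), (c,e), (d,e), (d,a), (e,a), (e,b)}"
  proof -
    define R where "R = {(b,a), (a,c), (b,c), (b,d), (c,d), (c,e), (d,e), (d,a), (e,a), (e,b)}"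
    have "\<forall>u\<in>S. \<forall>v\<in>S. u \<rightarrow>\<^bsub>G\<^esub> v \<longleftrightarrow> (u, v) \<in> R"
      unfolding S_def R_def by (simp add: U' irr neg ne ne[symmetric])
    then have R: "u \<rightarrow>\<^bsub>G\<^esub> v \<longleftrightarrow> (u, v) \<in> R" if "u \<in> S" "v \<in> S" for u v
      using that by (metis (no_types))
    have RS: "R \<subseteq> S \<times> S" unfolding S_def R_def by simp
    have ends: "arcs_ends (G \<restriction> S) = {(u, v). u \<in> S \<and> v \<in> S \<and> u \<rightarrow>\<^bsub>G\<^esub> v}"
      unfolding arcs_ends_conv by (auto simp: image_iff)
    have "(u, v) \<in> arcs_ends (G \<restriction> S) \<longleftrightarrow> (u, v) \<in> R" for u v
      using R[of u v] subsetD[OF RS, of "(u, v)"] unfolding ends by simp blast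
    then have "arcs_ends (G \<restriction> S) = R" by (intro set_eqI) (simp only: split_paired_all)
    then show ?thesis unfolding R_def .
  qed
  have iso: "pre_digraph.digraph_isomorphism (G \<restriction> S) h"
    unfolding pre_digraph.digraph_isomorphism_def
  proof (intro conjI)
    show "inj_on (iso_arcs h) (arcs (G \<restriction> S))"
    proof (rule inj_onI)
      fix x y assume xy: "x \<in> arcs (G \<restriction> S)" "y \<in> arcs (G \<restriction> S)" "iso_arcs h x = iso_arcs h y"
      then have "tail G x = tail G y" "head G x = head G y"
        using inj unfolding h_def by (auto dest: inj_onD)
      then show "x = y" using xy no_multi_arcs[of x y] unfolding arc_to_ends_def by auto
    qed
    show "wf_digraph (G \<restriction> S)" by (rule wellformed_induce_subgraph)
    show "inj_on (iso_verts h) (verts (G \<restriction> S))" using inj by (simp add: h_def)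
  qed (simp add: h_def)
  have "U5 = app_iso h (G \<restriction> S)"
  proof -
    have "iso_arcs h ` arcs (G \<restriction> S) = map_prod f f ` arcs_ends (G \<restriction> S)"
      unfolding h_def arcs_ends_conv image_image by simp
    also have "\<dots> = arcs U5" unfolding ends arcs_U5 using f by auto
    finally have "iso_arcs h ` arcs (G \<restriction> S) = arcs U5" .
    moreover have "iso_verts h ` verts (G \<restriction> S) = verts U5"
      unfolding h_def S_def U5_def using f interval_1_5 by auto
    ultimately show ?thesis unfolding app_iso_def by (simp add: h_def U5_def)
  qed
  with iso have "digraph_iso (G \<restriction> S) U5" unfolding digraph_iso_def by (intro exI[of _ h] conjI)
  with SV show ?thesis unfolding is_free_of_def by (simp only: not_not) (intro exI[of _ S] conjI)
qed

lemma U5_at_of_not_free: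
  assumes wf: "wf_digraph G" and "\<not> is_free_of G U5"
  shows "\<exists>a b c d e. U5_at (dominates G) a b c d e"
proof -
  obtain S h where h: "pre_digraph.digraph_isomorphism (G \<restriction> S) h" "U5 = app_iso h (G \<restriction> S)"
    using assms(2) unfolding is_free_of_def digraph_iso_def by blast
  define g where "g = the_inv_into S (iso_verts h)"
  have g: "g i \<rightarrow>\<^bsub>G\<^esub> g j" if ij: "(i, j) \<in> arcs U5" for i j
  proof -
    have "(i, j) \<in> iso_arcs h ` arcs (G \<restriction> S)" using ij unfolding h(2) by simp
    then obtain x where x: "x \<in> arcs G" "tail G x \<in> S" "head G x \<in> S" "iso_arcs h x = (i, j)"
      by auto
    have "iso_tail h = fst" "iso_head h = snd"
      using arg_cong[OF h(2), of tail] arg_cong[OF h(2), of head] unfolding U5_def app_iso_def by auto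
    then have "iso_verts h (tail G x) = i" "iso_verts h (head G x) = j" "inj_on (iso_verts h) S"
      using h(1) x unfolding pre_digraph.digraph_isomorphism_def by auto
    then have "g i = tail G x" "g j = head G x" unfolding g_def using x the_inv_into_f_f by fastforce+
    then show ?thesis unfolding arcs_ends_conv using x by auto
  qed
  have "U5_at (dominates G) (g 1) (g 2) (g 3) (g 4) (g 5)"
    unfolding U5_at_def by (intro conjI g) (simp_all add: arcs_U5)
  then show ?thesis by blast
qed

lemma U5_free_tournament_dominates:
  assumes "tournament G" "is_free_of G U5"
  shows "U5_free_tournament (verts G) (dominates G)"
proof -
  interpret tournament G by (rule assms)
  have irr: "\<not> x \<rightarrow>\<^bsub>G\<^esub> x" for x using no_loops unfolding arcs_ends_conv by auto
  show ?thesis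
  proof
    show "x \<in> verts G \<and> y \<in> verts G" if "x \<rightarrow>\<^bsub>G\<^esub> y" for x y using that adj_in_verts by auto
    then show "\<not> y \<rightarrow>\<^bsub>G\<^esub> x" if "x \<rightarrow>\<^bsub>G\<^esub> y" for x y
      using that exactly_one_direction[of x y] irr by metis
    show "x \<rightarrow>\<^bsub>G\<^esub> y \<or> y \<rightarrow>\<^bsub>G\<^esub> x" if "x \<in> verts G" "y \<in> verts G" "x \<noteq> y" for x y
      using exactly_one_direction that by blast
    show "\<not> U5_at (dominates G) a b c d e" for a b c d e
      using U5_at_not_free assms(2) by blast
  qed simp
qed

section \<open>Iterated substitution of the cyclic triangle\<close>

fun ternary :: "nat \<Rightarrow> nat \<Rightarrow> nat \<Rightarrow> bool" where
  "ternary 0 i j \<longleftrightarrow> False"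
| "ternary (Suc k) i j \<longleftrightarrow>
    (if i mod 3 = j mod 3 then ternary k (i div 3) (j div 3) else j mod 3 = (i mod 3 + 1) mod 3)"

text \<open>Vertices are strings of \<open>k\<close> ternary digits. The lowest digit names one of
  three outer copies, cyclically arranged, and the remaining digits give the place inside the
  copy.\<close>

definition ternary_digraph :: "nat \<Rightarrow> (nat, nat \<times> nat) pre_digraph" where
  "ternary_digraph k = \<lparr>verts = {..<3 ^ k}, arcs = {(i, j). i < 3 ^ k \<and> j < 3 ^ k \<and> ternary k i j},
     tail = fst, head = snd\<rparr>"

lemma mod_3_cases: "(n::nat) mod 3 = 0 \<or> n mod 3 = 1 \<or> n mod 3 = 2"
  by auto

lemma ternary_asym: "ternary k i j \<Longrightarrow> \<not> ternary k j i"
proof (induction k arbitrary: i j)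
  case (Suc k)
  then show ?case using mod_3_cases[of i] mod_3_cases[of j] by (auto split: if_splits)
qed simp

lemma ternary_total: "i < 3 ^ k \<Longrightarrow> j < 3 ^ k \<Longrightarrow> i \<noteq> j \<Longrightarrow> ternary k i j \<or> ternary k j i"
proof (induction k arbitrary: i j)
  case (Suc k)
  show ?case
  proof (cases "i mod 3 = j mod 3")
    case True
    then have "i div 3 \<noteq> j div 3" using Suc.prems by (metis div_mult_mod_eq)
    moreover have "i div 3 < 3 ^ k" "j div 3 < 3 ^ k" using Suc.prems by auto
    ultimately show ?thesis using Suc.IH True by auto
  next
    case False
    then show ?thesis using mod_3_cases[of i] mod_3_cases[of j] by auto
  qed
qed simp

text \<open>Three steps of 0 or 1 whose sum is divisible by 3 are all 0 or all 1.\<close>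

lemma closed_steps_mod_3:
  fixes x y z :: nat
  assumes "x < 3" "y < 3" "z < 3"
    and "x = y \<or> y = (x + 1) mod 3" "y = z \<or> z = (y + 1) mod 3" "z = x \<or> x = (z + 1) mod 3"
  shows "x = y \<and> y = z \<or> x \<noteq> y \<and> x \<noteq> z \<and> y \<noteq> z"
proof -
  have "x = 0 \<or> x = 1 \<or> x = 2" using assms(1) by auto
  then show ?thesis using assms(4-) by auto
qed

text \<open>Four cyclic triangles of \<open>U5\<close> overlap so much that none can be spread over
  three copies: otherwise \<open>s = t\<close> for want of a fourth value, and the triangles through
  \<open>q\<close> force \<open>r = t\<close> as well.\<close>

lemma cyclic_steps_U5:
  fixes p q r s t :: nat
  assumes "p < 3" "q < 3" "r < 3" "s < 3" "t < 3"
    and "p = r \<or> r = (p + 1) mod 3" "q = r \<or> r = (q + 1) mod 3"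
      "q = s \<or> s = (q + 1) mod 3" "r = s \<or> s = (r + 1) mod 3" "r = t \<or> t = (r + 1) mod 3"
      "s = t \<or> t = (s + 1) mod 3"
      "s = p \<or> p = (s + 1) mod 3" "t = p \<or> p = (t + 1) mod 3" "t = q \<or> q = (t + 1) mod 3"
  shows "p = q \<and> p = r \<and> p = s \<and> p = t"
proof -
  have "p = r \<and> r = s \<or> p \<noteq> r \<and> p \<noteq> s \<and> r \<noteq> s" by (rule closed_steps_mod_3) fact+
  moreover have "p = r \<and> r = t \<or> p \<noteq> r \<and> p \<noteq> t \<and> r \<noteq> t" by (rule closed_steps_mod_3) fact+
  moreover have "q = s \<and> s = t \<or> q \<noteq> s \<and> q \<noteq> t \<and> s \<noteq> t" by (rule closed_steps_mod_3) fact+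
  moreover have "q = r \<and> r = t \<or> q \<noteq> r \<and> q \<noteq> t \<and> r \<noteq> t" by (rule closed_steps_mod_3) fact+
  moreover have "s = t" if "p \<noteq> r" "p \<noteq> s" "r \<noteq> s" "p \<noteq> t" "r \<noteq> t"
    using assms(1-5) that by linarith
  ultimately show ?thesis by metis
qed
text \<open>By \<open>cyclic_steps_U5\<close> a copy of \<open>U5\<close> has a common lowest digit,
  and dropping it leaves a copy one level below.\<close>

lemma ternary_U5: "\<not> U5_at (ternary k) a b c d e"
proof (induction k arbitrary: a b c d e)
  case 0
  then show ?case by (simp add: U5_at_def)
next
  case (Suc k)
  show ?case
  proof
    assume U: "U5_at (ternary (Suc k)) a b c d e"
    have step: "x mod 3 = y mod 3 \<or> y mod 3 = (x mod 3 + 1) mod 3"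
      if "ternary (Suc k) x y" for x y
      using that by (auto split: if_splits)
    have "a mod 3 = b mod 3 \<and> a mod 3 = c mod 3 \<and> a mod 3 = d mod 3 \<and> a mod 3 = e mod 3"
      by (rule cyclic_steps_U5; (rule step)?; use U in \<open>simp add: U5_at_def del: ternary.simps\<close>)
    then have "U5_at (ternary k) (a div 3) (b div 3) (c div 3) (d div 3) (e div 3)"
      using U unfolding U5_at_def by simp
    then show False using Suc.IH by blast
  qed
qed

text \<open>Vertices from all three outer copies would form a cyclic triangle, so at most two copies
  are met, each in at most \<open>2 ^ k\<close> vertices by induction.\<close>

lemma ternary_triangle_free:
  "S \<subseteq> {..<3 ^ k} \<Longrightarrow> triangle_free_on (ternary k) S \<Longrightarrow> card S \<le> 2 ^ k"
proof (induction k arbitrary: S)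
  case 0
  then have "card S \<le> card {0::nat}" by (intro card_mono) auto
  then show ?case by simp
next
  case (Suc k)
  define X where "X r = {i \<in> S. i mod 3 = r}" for r
  have finS: "finite S" using Suc.prems(1) finite_subset by blast
  have X: "card (X r) \<le> 2 ^ k" for r
  proof -
    have "inj_on (\<lambda>i. i div 3) (X r)"
      unfolding X_def by (rule inj_onI) (metis (mono_tags, lifting) div_mult_mod_eq mem_Collect_eq)
    then have "card (X r) = card ((\<lambda>i. i div 3) ` X r)" by (simp add: card_image)
    also have "\<dots> \<le> 2 ^ k"
    proof (rule Suc.IH)
      show "(\<lambda>i. i div 3) ` X r \<subseteq> {..<3 ^ k}" using Suc.prems(1) unfolding X_def by auto
      show "triangle_free_on (ternary k) ((\<lambda>i. i div 3) ` X r)"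
        unfolding triangle_free_on_def
      proof (intro ballI notI)
        fix a b c assume "a \<in> (\<lambda>i. i div 3) ` X r" "b \<in> (\<lambda>i. i div 3) ` X r" "c \<in> (\<lambda>i. i div 3) ` X r"
          and T: "ternary k a b \<and> ternary k b c \<and> ternary k c a"
        then obtain x y z where "x \<in> X r" "y \<in> X r" "z \<in> X r" "a = x div 3" "b = y div 3" "c = z div 3"
          by blast
        then show False using T triangle_free_onD[OF Suc.prems(2), of x y z] unfolding X_def by auto
      qed
    qed
    finally show ?thesis .
  qed
  have "X 0 = {} \<or> X 1 = {} \<or> X 2 = {}"
  proof (rule ccontr)
    assume "\<not> ?thesis"
    then obtain x y z where "x \<in> X 0" "y \<in> X 1" "z \<in> X 2" by blast
    then show False using triangle_free_onD[OF Suc.prems(2), of x y z] unfolding X_def by auto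
  qed
  moreover have "S = X 0 \<union> X 1 \<union> X 2" unfolding X_def by auto
  then have "card S = card (X 0 \<union> X 1 \<union> X 2)" by (rule arg_cong)
  then have "card S \<le> card (X 0) + card (X 1) + card (X 2)"
    using card_Un_le[of "X 0 \<union> X 1" "X 2"] card_Un_le[of "X 0" "X 1"] by linarith
  ultimately show ?case using X[of 0] X[of 1] X[of 2] by auto
qed

lemma dominates_ternary:
  "i \<rightarrow>\<^bsub>ternary_digraph k\<^esub> j \<longleftrightarrow> i < 3 ^ k \<and> j < 3 ^ k \<and> ternary k i j"
  unfolding arcs_ends_conv ternary_digraph_def by auto

lemma tournament_ternary: "tournament (ternary_digraph k)"
proof
  have "arcs (ternary_digraph k) \<subseteq> {..<3 ^ k} \<times> {..<3 ^ k}" unfolding ternary_digraph_def by auto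
  then show "finite (arcs (ternary_digraph k))" by (rule finite_subset) simp
  show "(u \<rightarrow>\<^bsub>ternary_digraph k\<^esub> v) \<noteq> (v \<rightarrow>\<^bsub>ternary_digraph k\<^esub> u)"
    if "u \<in> verts (ternary_digraph k)" "v \<in> verts (ternary_digraph k)" "u \<noteq> v" for u v
    using that ternary_asym[of k u v] ternary_total[of u k v] unfolding dominates_ternary
    by (auto simp: ternary_digraph_def)
  have "\<not> ternary k i i" for i using ternary_asym by blast
  then show "tail (ternary_digraph k) e \<noteq> head (ternary_digraph k) e" if "e \<in> arcs (ternary_digraph k)" for e
    using that by (auto simp: ternary_digraph_def)
qed (auto simp: ternary_digraph_def arc_to_ends_def)

lemma ternary_free: "is_free_of (ternary_digraph k) U5"
proof (rule ccontr)
  interpret tournament "ternary_digraph k" by (rule tournament_ternary)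
  assume "\<not> is_free_of (ternary_digraph k) U5"
  then obtain a b c d e where "U5_at (dominates (ternary_digraph k)) a b c d e"
    using U5_at_of_not_free[OF wf_digraph] by blast
  then have "U5_at (ternary k) a b c d e" unfolding U5_at_def dominates_ternary by blast
  then show False using ternary_U5 by blast
qed

lemma powr_3_log: "real (3 ^ k) powr log 3 2 = 2 ^ k"
proof -
  have "real (3 ^ k) powr log 3 2 = (3 powr real k) powr log 3 2" by (simp add: powr_realpow)
  also have "\<dots> = (3 powr log 3 2) powr real k" by (simp only: powr_powr mult.commute)
  also have "\<dots> = 2 ^ k" by (simp add: powr_realpow)
  finally show ?thesis .
qed

lemma ternary_transitive:
  assumes "S \<subseteq> verts (ternary_digraph k)" "is_transitive (ternary_digraph k \<restriction> S)"
  shows "real (card S) \<le> real (card (verts (ternary_digraph k))) powr log 3 2"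
proof -
  have S: "S \<subseteq> {..<3 ^ k}" using assms(1) by (simp add: ternary_digraph_def)
  have "triangle_free_on (dominates (ternary_digraph k)) S"
    using assms is_transitive_restrict by blast
  then have "triangle_free_on (ternary k) S"
    using S unfolding triangle_free_on_def dominates_ternary by blast
  then have "card S \<le> 2 ^ k" using S ternary_triangle_free by blast
  then have "real (card S) \<le> real (2 ^ k)" by (rule of_nat_mono)
  then show ?thesis using powr_3_log[of k] by (simp add: ternary_digraph_def)
qed

lemma digraph_iso_card: "digraph_iso G H \<Longrightarrow> card (verts G) = card (verts H)"
  unfolding digraph_iso_def pre_digraph.digraph_isomorphism_def by (auto simp: card_image)

theorem theorem6p1:
  shows "(\<forall>G :: ('a, 'b) pre_digraph. tournament G \<and> is_free_of G U5 \<longrightarrow>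
           (\<exists>S \<subseteq> verts G. is_transitive (G \<restriction> S) \<and>
              real (card S) \<ge> real (card (verts G)) powr log 3 2)) \<and>
         (\<exists>\<G> :: (nat, nat \<times> nat) pre_digraph set.
           infinite \<G> \<and>
           (\<forall>G \<in> \<G>. \<forall>H \<in> \<G>. digraph_iso G H \<longrightarrow> G = H) \<and>
           (\<forall>G \<in> \<G>. tournament G \<and> is_free_of G U5 \<and>
              \<not> (\<exists>S \<subseteq> verts G. is_transitive (G \<restriction> S) \<and>
                   real (card S) > real (card (verts G)) powr log 3 2)))"
proof (intro conjI)
  show "\<forall>G :: ('a, 'b) pre_digraph. tournament G \<and> is_free_of G U5 \<longrightarrow>
           (\<exists>S \<subseteq> verts G. is_transitive (G \<restriction> S) \<and>
              real (card S) \<ge> real (card (verts G)) powr log 3 2)"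
  proof (intro allI impI)
    fix G :: "('a, 'b) pre_digraph" assume G: "tournament G \<and> is_free_of G U5"
    then obtain S where "S \<subseteq> verts G" "triangle_free_on (dominates G) S"
      "real (card (verts G)) powr log 3 2 \<le> real (card S)"
      using U5_free_card[OF U5_free_tournament_dominates] by blast
    then show "\<exists>S \<subseteq> verts G. is_transitive (G \<restriction> S) \<and>
        real (card S) \<ge> real (card (verts G)) powr log 3 2"
      using is_transitive_restrict by blast
  qed
  \<comment> \<open>Different levels have different numbers \<open>3 ^ k\<close> of
    vertices.\<close>
  have iso: "k = l" if "digraph_iso (ternary_digraph k) (ternary_digraph l)" for k l
    using digraph_iso_card[OF that] by (simp add: ternary_digraph_def)
  have "inj ternary_digraph"
  proof (rule injI)
    fix k l assume "ternary_digraph k = ternary_digraph l"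
    then have "card (verts (ternary_digraph k)) = card (verts (ternary_digraph l))" by simp
    then show "k = l" by (simp add: ternary_digraph_def)
  qed
  then have inf: "infinite (range ternary_digraph)" by (rule range_inj_infinite)
  show "\<exists>\<G> :: (nat, nat \<times> nat) pre_digraph set.
           infinite \<G> \<and>
           (\<forall>G \<in> \<G>. \<forall>H \<in> \<G>. digraph_iso G H \<longrightarrow> G = H) \<and>
           (\<forall>G \<in> \<G>. tournament G \<and> is_free_of G U5 \<and>
              \<not> (\<exists>S \<subseteq> verts G. is_transitive (G \<restriction> S) \<and>
                   real (card S) > real (card (verts G)) powr log 3 2))"
  proof (intro exI[of _ "range ternary_digraph"] conjI inf ballI impI)
    fix G H assume GH: "G \<in> range ternary_digraph" "H \<in> range ternary_digraph" "digraph_iso G H"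
    then obtain k l where "G = ternary_digraph k" "H = ternary_digraph l" by blast
    then show "G = H" using iso GH(3) by blast
  next
    fix G assume "G \<in> range ternary_digraph"
    then obtain k where G: "G = ternary_digraph k" by blast
    show "tournament G" "is_free_of G U5" unfolding G by (rule tournament_ternary ternary_free)+
    show "\<not> (\<exists>S \<subseteq> verts G. is_transitive (G \<restriction> S) \<and>
        real (card S) > real (card (verts G)) powr log 3 2)"
      using ternary_transitive[of _ k] unfolding G by (meson not_less)
  qed
qed

end
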